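(* There exists an $L^1$-quasidisk $\Omega\subset\mathbb{R}^2$ which is not a Sobolev $(p,q)$-extension domain for any pair of exponents $1\leq q\leq p<\infty$.
   Context: Homeomorphism of finite distortion: for a domain $\Omega\subset\mathbb{R}^2$, a homeomorphism $h$ of $\Omega$ onto $h(\Omega)\subset\mathbb{R}^2$ has finite distortion if $h\in W^{1,1}_{\rm loc}(\Omega,\mathbb{R}^2)$ and there is a measurable function $K:\Omega\to[1,\infty]$ with $K(z)<\infty$ almost everywhere such that $|Dh(z)|^2\leq K(z)J_h(z)$ for almost every $z\in\Omega$, where $|Dh|$ is the operator norm of the weak differential and $J_h=\det Dh$. The optimal distortion function is $K_h(z):=|Dh(z)|^2/J_h(z)$ if $J_h(z)>0$ and $K_h(z):=1$ if $J_h(z)=0$. $L^p$-quasidisk ($1\leq p\leq\infty$): a bounded simply connected domain $\Omega\subset\mathbb{R}^2$ for which there exists a homeomorphism of finite distortion $h$ of $\mathbb{R}^2$ onto $\mathbb{R}^2$ with $h(\Omega)=\mathbb{D}$ and $K_h\in L^p_{\rm loc}(\mathbb{R}^2)$. Here $\mathbb{D}=B(0,1)$ is the open unit disk. Sobolev space: for $1\leq p<\infty$, $W^{1,p}(\Omega)$ is the space of weakly differentiable $u\in L^p(\Omega)$ with $|\nabla u|\in L^p(\Omega)$, with norm $\|u\|_{W^{1,p}(\Omega)}=\left(\int_\Omega |u|^p+|\nabla u|^p\,dz\right)^{1/p}$. Sobolev $(p,q)$-extension domain ($1\leq q\leq p\leq\infty$): a bounded domain $\Omega\subset\mathbb{R}^2$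 such that there is a constant $C$ for which every $u\in W^{1,p}(\Omega)$ admits a function $E(u)\in W^{1,q}(\mathbb{R}^2)$ with $E(u)|_\Omega\equiv u$ and $\|E(u)\|_{W^{1,q}(\mathbb{R}^2)}\leq C\|u\|_{W^{1,p}(\Omega)}$, with $C$ independent of $u$. *)

theory Defs
  imports "HOL-Analysis.Analysis"
begin

section \<open>Weak derivatives\<close>

definition partial_deriv :: "2 \<Rightarrow> (real^2 \<Rightarrow> real) \<Rightarrow> real^2 \<Rightarrow> real" where
  "partial_deriv i f x = frechet_derivative f (at x) (axis i 1)"

primrec C_times :: "nat \<Rightarrow> (real^2 \<Rightarrow> real) \<Rightarrow> bool" where
  "C_times 0 f \<longleftrightarrow> continuous_on UNIV f"
| "C_times (Suc k) f \<longleftrightarrow>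
     (\<forall>x. f differentiable (at x)) \<and> (\<forall>i. C_times k (partial_deriv i f))"

definition test_function :: "(real^2) set \<Rightarrow> (real^2 \<Rightarrow> real) \<Rightarrow> bool" where
  "test_function \<Omega> \<phi> \<longleftrightarrow>
     (\<forall>k. C_times k \<phi>) \<and>
     compact (closure {x. \<phi> x \<noteq> 0}) \<and> closure {x. \<phi> x \<noteq> 0} \<subseteq> \<Omega>"

text \<open>Functions on \<open>\<Omega>\<close> are represented by total functions on the plane whose values
  outside \<open>\<Omega>\<close> are irrelevant. Measurability is always Lebesgue measurability.\<close>

definition in_Lp :: "real \<Rightarrow> (real^2) set \<Rightarrow> (real^2 \<Rightarrow> 'b::euclidean_space) \<Rightarrow> bool" where
  "in_Lp p \<Omega> f \<longleftrightarrow>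
     f \<in> borel_measurable (lebesgue_on \<Omega>) \<and>
     integrable (lebesgue_on \<Omega>) (\<lambda>x. norm (f x) powr p)"

definition in_Lp_loc :: "real \<Rightarrow> (real^2) set \<Rightarrow> (real^2 \<Rightarrow> 'b::euclidean_space) \<Rightarrow> bool" where
  "in_Lp_loc p \<Omega> f \<longleftrightarrow> (\<forall>C. compact C \<and> C \<subseteq> \<Omega> \<longrightarrow> in_Lp p C f)"

definition has_weak_gradient ::
  "(real^2) set \<Rightarrow> (real^2 \<Rightarrow> real) \<Rightarrow> (real^2 \<Rightarrow> real^2) \<Rightarrow> bool" where
  "has_weak_gradient \<Omega> u G \<longleftrightarrow>
     in_Lp_loc 1 \<Omega> u \<and> in_Lp_loc 1 \<Omega> G \<and>
     (\<forall>\<phi> i. test_function \<Omega> \<phi> \<longrightarrow>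
        integral\<^sup>L (lebesgue_on \<Omega>) (\<lambda>x. u x * partial_deriv i \<phi> x) =
        - integral\<^sup>L (lebesgue_on \<Omega>) (\<lambda>x. G x $ i * \<phi> x))"

text \<open>A weak gradient is unique only up to null sets; the choice made here is immaterial in
  everything below. The same applies to the weak differential.\<close>

definition weak_gradient :: "(real^2) set \<Rightarrow> (real^2 \<Rightarrow> real) \<Rightarrow> real^2 \<Rightarrow> real^2" where
  "weak_gradient \<Omega> u = (SOME G. has_weak_gradient \<Omega> u G)"

definition weakly_differentiable :: "(real^2) set \<Rightarrow> (real^2 \<Rightarrow> real) \<Rightarrow> bool" where
  "weakly_differentiable \<Omega> u \<longleftrightarrow> (\<exists>G. has_weak_gradient \<Omega> u G)"

definition has_weak_differential ::
  "(real^2) set \<Rightarrow> (real^2 \<Rightarrow> real^2) \<Rightarrow> (real^2 \<Rightarrow> real^2^2) \<Rightarrow> bool" where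
  "has_weak_differential \<Omega> h A \<longleftrightarrow>
     (\<forall>i. has_weak_gradient \<Omega> (\<lambda>x. h x $ i) (\<lambda>x. A x $ i))"

definition weak_differential :: "(real^2) set \<Rightarrow> (real^2 \<Rightarrow> real^2) \<Rightarrow> real^2 \<Rightarrow> real^2^2" where
  "weak_differential \<Omega> h = (SOME A. has_weak_differential \<Omega> h A)"

text \<open>Local integrability of the map and of its differential, which membership in
  \<open>W\<close>-\<open>1,1\<close>-\<open>loc\<close> requires, is part of \<^const>\<open>has_weak_gradient\<close>.\<close>

definition in_W11_loc :: "(real^2) set \<Rightarrow> (real^2 \<Rightarrow> real^2) \<Rightarrow> bool" where
  "in_W11_loc \<Omega> h \<longleftrightarrow> (\<exists>A. has_weak_differential \<Omega> h A)"


section \<open>Homeomorphisms of finite distortion and quasidisks\<close>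

definition domain :: "(real^2) set \<Rightarrow> bool" where
  "domain \<Omega> \<longleftrightarrow> open \<Omega> \<and> connected \<Omega> \<and> \<Omega> \<noteq> {}"

definition Dnorm :: "(real^2) set \<Rightarrow> (real^2 \<Rightarrow> real^2) \<Rightarrow> real^2 \<Rightarrow> real" where
  "Dnorm \<Omega> h z = onorm (\<lambda>v. weak_differential \<Omega> h z *v v)"

definition jacobian :: "(real^2) set \<Rightarrow> (real^2 \<Rightarrow> real^2) \<Rightarrow> real^2 \<Rightarrow> real" where
  "jacobian \<Omega> h z = det (weak_differential \<Omega> h z)"

definition finite_distortion_homeo :: "(real^2) set \<Rightarrow> (real^2 \<Rightarrow> real^2) \<Rightarrow> bool" where
  "finite_distortion_homeo \<Omega> h \<longleftrightarrow>
     domain \<Omega> \<and>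
     (\<exists>g. homeomorphism \<Omega> (h ` \<Omega>) h g) \<and>
     in_W11_loc \<Omega> h \<and>
     (\<exists>K :: real^2 \<Rightarrow> ereal.
        K \<in> borel_measurable (lebesgue_on \<Omega>) \<and>
        (\<forall>z\<in>\<Omega>. 1 \<le> K z) \<and>
        (AE z in lebesgue_on \<Omega>. K z < \<infinity>) \<and>
        (AE z in lebesgue_on \<Omega>. ereal ((Dnorm \<Omega> h z)\<^sup>2) \<le> K z * ereal (jacobian \<Omega> h z)))"

text \<open>For a homeomorphism of finite distortion the Jacobian is nonnegative almost everywhere,
  so the second branch concerns, up to a null set, the points where it vanishes.\<close>

definition optimal_distortion :: "(real^2) set \<Rightarrow> (real^2 \<Rightarrow> real^2) \<Rightarrow> real^2 \<Rightarrow> real" where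
  "optimal_distortion \<Omega> h z =
     (if jacobian \<Omega> h z > 0 then (Dnorm \<Omega> h z)\<^sup>2 / jacobian \<Omega> h z else 1)"

text \<open>Finite exponents \<open>p\<close> only.\<close>

definition Lp_quasidisk :: "real \<Rightarrow> (real^2) set \<Rightarrow> bool" where
  "Lp_quasidisk p \<Omega> \<longleftrightarrow>
     domain \<Omega> \<and> bounded \<Omega> \<and> simply_connected \<Omega> \<and>
     (\<exists>h. finite_distortion_homeo UNIV h \<and> range h = UNIV \<and> h ` \<Omega> = ball 0 1 \<and>
          in_Lp_loc p UNIV (optimal_distortion UNIV h))"


section \<open>Sobolev extension domains\<close>

definition in_W1p :: "real \<Rightarrow> (real^2) set \<Rightarrow> (real^2 \<Rightarrow> real) \<Rightarrow> bool" where
  "in_W1p p \<Omega> u \<longleftrightarrow>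
     weakly_differentiable \<Omega> u \<and> in_Lp p \<Omega> u \<and> in_Lp p \<Omega> (weak_gradient \<Omega> u)"

definition W1p_norm :: "real \<Rightarrow> (real^2) set \<Rightarrow> (real^2 \<Rightarrow> real) \<Rightarrow> real" where
  "W1p_norm p \<Omega> u =
     (integral\<^sup>L (lebesgue_on \<Omega>)
        (\<lambda>z. \<bar>u z\<bar> powr p + norm (weak_gradient \<Omega> u z) powr p)) powr (1 / p)"

text \<open>Finite exponents only. Elements of Sobolev spaces are classes modulo null sets, so the
  extension has to agree with \<open>u\<close> almost everywhere on \<open>\<Omega>\<close>.\<close>

definition sobolev_extension_domain :: "real \<Rightarrow> real \<Rightarrow> (real^2) set \<Rightarrow> bool" where
  "sobolev_extension_domain p q \<Omega> \<longleftrightarrow>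
     domain \<Omega> \<and> bounded \<Omega> \<and>
     (\<exists>C. \<forall>u. in_W1p p \<Omega> u \<longrightarrow>
        (\<exists>v. in_W1p q UNIV v \<and> (AE z in lebesgue_on \<Omega>. v z = u z) \<and>
             W1p_norm q UNIV v \<le> C * W1p_norm p \<Omega> u))"

end

theory Submission
  imports Defs
begin

text \<open>
  The domain is a planar region with two exponential outward cusps,
  \<open>\<Omega> = {(x, y). \<bar>x\<bar> < 1, \<bar>y\<bar> < s(x) m(x)}\<close> with \<open>s(x) = sqrt (1 - x\<^sup>2)\<close> and
  \<open>m(x) = exp (-1 / (1 - x\<^sup>2))\<close>.

  \<^emph>\<open>Why it is a quasidisk.\<close> Membership of \<open>K\<^sub>h\<close> in \<open>L\<^sup>1\<close> means that the inverse of \<open>h\<close> has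
  locally finite Dirichlet energy, and squeezing the disc vertically onto \<open>\<Omega>\<close> costs little energy however
  thin the cusps are. On each vertical line with \<open>\<bar>x\<bar> < 1\<close> the inverse map \<open>squeeze\<close> scales
  \<open>[-s, s]\<close> by the factor \<open>m\<close>, maps the two remaining parts of \<open>[-2 s, 2 s]\<close> affinely, and is the
  identity elsewhere. It is a homeomorphism by invariance of domain. Its inverse \<open>stretch\<close> is
  piecewise smooth along almost every coordinate line, which identifies its weak differential, and the
  distortion is dominated by \<open>distortion_bound\<close>, which is \<open>O(1 / m)\<close> on a vertical segment of
  length \<open>2 s m\<close>, \<open>O(1 / s\<^sup>2)\<close> on segments of total length at most \<open>4 s\<close>, and bounded elsewhere.
  After integration in \<open>y\<close> only \<open>O(1 / s)\<close> is left, which is integrable over \<open>(-1, 1)\<close>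
  (lemma \<open>distortion_bound_integrable\<close>).

  \<^emph>\<open>Why it is not an extension domain.\<close> The function \<open>u(x, y) = (1 - x\<^sup>2)\<^sup>-\<^sup>2\<close> lies in \<open>W\<^sup>1\<^sup>,\<^sup>p\<close> of
  \<open>\<Omega>\<close> for every finite \<open>p\<close>, because the exponential decay of \<open>m\<close> beats every power of
  \<open>1 - x\<^sup>2\<close>. A function of class \<open>W\<^sup>1\<^sup>,\<^sup>1\<close> near the cusps has an integrable trace on the
  segment \<open>y = 0\<close>, but \<open>(1 - x\<^sup>2)\<^sup>-\<^sup>2\<close> is not integrable over \<open>(-1, 1)\<close>; so one and the same \<open>u\<close>
  has no weakly differentiable extension at all. In lemma \<open>cusp_function_no_extension\<close> the trace
  argument is carried out by testing \<open>\<partial>\<^sub>y\<close> against functions that jump across a thin strip contained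
  in \<open>\<Omega>\<close>.

  Weak gradients enter both parts as arbitrary representatives, so their uniqueness up to null sets
  (the fundamental lemma of the calculus of variations) is proved as well.
\<close>

section \<open>Smooth functions of one real variable\<close>

text \<open>\<open>k\<close> times continuously differentiable functions on the line.\<close>

primrec Ck :: "nat \<Rightarrow> (real \<Rightarrow> real) \<Rightarrow> bool" where
  "Ck 0 f \<longleftrightarrow> continuous_on UNIV f"
| "Ck (Suc k) f \<longleftrightarrow> (\<exists>f'. (\<forall>x. (f has_real_derivative f' x) (at x)) \<and> Ck k f')"

text \<open>Infinitely differentiable functions on the line.\<close>

definition smooth :: "(real \<Rightarrow> real) \<Rightarrow> bool" where
  "smooth f \<longleftrightarrow> (\<forall>k. Ck k f)"

lemma Ck_Suc_D: "Ck (Suc k) f \<Longrightarrow> Ck k f"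
proof (induction k arbitrary: f)
  case 0
  then show ?case
    by (auto simp: continuous_on_eq_continuous_within intro: DERIV_isCont)
next
  case (Suc k)
  then show ?case by (metis Ck.simps(2))
qed

lemma Ck_const: "Ck k (\<lambda>x. c)"
  by (induction k arbitrary: c) (auto intro!: exI[of _ "\<lambda>x. 0"])

lemma Ck_add: "Ck k f \<Longrightarrow> Ck k g \<Longrightarrow> Ck k (\<lambda>x. f x + g x)"
proof (induction k arbitrary: f g)
  case (Suc k)
  then obtain f' g' where "\<And>x. (f has_real_derivative f' x) (at x)" "Ck k f'"
    "\<And>x. (g has_real_derivative g' x) (at x)" "Ck k g'" by auto
  with Suc.IH show ?case by (auto intro!: exI[of _ "\<lambda>x. f' x + g' x"] derivative_eq_intros)
qed (auto intro: continuous_intros)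

lemma Ck_mult: "Ck k f \<Longrightarrow> Ck k g \<Longrightarrow> Ck k (\<lambda>x. f x * g x)"
proof (induction k arbitrary: f g)
  case (Suc k)
  then obtain f' g' where *: "\<And>x. (f has_real_derivative f' x) (at x)" "Ck k f'"
    "\<And>x. (g has_real_derivative g' x) (at x)" "Ck k g'" by auto
  moreover have "Ck k f" "Ck k g" using Suc.prems[THEN Ck_Suc_D] by auto
  ultimately have "Ck k (\<lambda>x. f' x * g x + f x * g' x)"
    by (intro Ck_add Suc.IH)
  with * show ?case
    by (auto intro!: exI[of _ "\<lambda>x. f' x * g x + f x * g' x"] derivative_eq_intros)
qed (auto intro: continuous_intros)

lemma Ck_exp: "Ck k f \<Longrightarrow> Ck k (\<lambda>x. exp (f x))"
proof (induction k arbitrary: f)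
  case (Suc k)
  then obtain f' where *: "\<And>x. (f has_real_derivative f' x) (at x)" "Ck k f'" by auto
  have "Ck k f" using Suc.prems by (rule Ck_Suc_D)
  then have "Ck k (\<lambda>x. exp (f x) * f' x)"
    using * by (intro Ck_mult Suc.IH)
  with * show ?case
    by (auto intro!: exI[of _ "\<lambda>x. exp (f x) * f' x"] derivative_eq_intros)
qed (auto intro: continuous_intros)

lemma Ck_affine: "Ck k f \<Longrightarrow> Ck k (\<lambda>x. f (a * x + b))"
proof (induction k arbitrary: f)
  case 0
  then have "continuous_on UNIV (f \<circ> (\<lambda>x. a * x + b))"
    by (intro continuous_on_compose continuous_intros) (auto intro: continuous_on_subset)
  then show ?case by (simp add: o_def)
next
  case (Suc k)
  then obtain f' where *: "\<And>x. (f has_real_derivative f' x) (at x)" "Ck k f'" by auto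
  have "Ck k (\<lambda>x. f' (a * x + b) * a)"
    by (intro Ck_mult Ck_const Suc.IH *)
  moreover have "((\<lambda>x. f (a * x + b)) has_real_derivative f' (a * x + b) * a) (at x)" for x
    by (rule DERIV_chain'[where f="\<lambda>x. a * x + b"]) (auto intro!: derivative_eq_intros *)
  ultimately show ?case
    unfolding Ck.simps(2) by (intro exI[of _ "\<lambda>x. f' (a * x + b) * a"] conjI allI)
qed

lemma smooth_const: "smooth (\<lambda>x. c)" by (simp add: smooth_def Ck_const)
lemma smooth_add: "smooth f \<Longrightarrow> smooth g \<Longrightarrow> smooth (\<lambda>x. f x + g x)"
  by (simp add: smooth_def Ck_add)
lemma smooth_mult: "smooth f \<Longrightarrow> smooth g \<Longrightarrow> smooth (\<lambda>x. f x * g x)"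
  by (simp add: smooth_def Ck_mult)
lemma smooth_exp: "smooth f \<Longrightarrow> smooth (\<lambda>x. exp (f x))"
  by (simp add: smooth_def Ck_exp)
lemma smooth_affine: "smooth f \<Longrightarrow> smooth (\<lambda>x. f (a * x + b))"
  by (simp add: smooth_def Ck_affine)

lemma smooth_antiderivative:
  assumes "smooth f'" "\<And>x. (f has_real_derivative f' x) (at x)"
  shows "smooth f"
  unfolding smooth_def
proof
  fix k show "Ck k f"
  proof (rule Ck_Suc_D)
    show "Ck (Suc k) f"
      using assms unfolding smooth_def Ck.simps(2) by blast
  qed
qed

lemma smooth_has_derivative:
  assumes "smooth f"
  shows "(f has_real_derivative deriv f x) (at x)"
proof -
  have "Ck (Suc 0) f" using assms unfolding smooth_def by blast
  then obtain f' where "(f has_real_derivative f' x) (at x)" by auto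
  then show ?thesis by (metis DERIV_imp_deriv)
qed

lemma smooth_deriv:
  assumes "smooth f" shows "smooth (deriv f)"
  unfolding smooth_def
proof
  fix k
  have "Ck (Suc k) f" using assms unfolding smooth_def by blast
  then obtain f' where f': "\<And>x. (f has_real_derivative f' x) (at x)" "Ck k f'" by auto
  then have "deriv f = f'" by (auto intro: DERIV_imp_deriv)
  with f' show "Ck k (deriv f)" by simp
qed

lemma smooth_continuous: "smooth f \<Longrightarrow> continuous_on UNIV f"
  using Ck.simps(1) unfolding smooth_def by blast

text \<open>The standard smooth function that is flat at \<open>0\<close>.\<close>

definition flat :: "real \<Rightarrow> real" where
  "flat t = (if t > 0 then exp (- 1 / t) else 0)"

text \<open>The derivatives of \<^const>\<open>flat\<close> are of this form; the family is closed under differentiation.\<close>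

definition flat_poly :: "real poly \<Rightarrow> real \<Rightarrow> real" where
  "flat_poly p t = (if t > 0 then poly p (1 / t) * exp (- 1 / t) else 0)"

lemma poly_times_exp_tendsto_0: "((\<lambda>x::real. poly p x * exp (- x)) \<longlongrightarrow> 0) at_top"
proof -
  have "((\<lambda>x. \<Sum>i\<le>degree p. coeff p i * (x ^ i / exp x)) \<longlongrightarrow> (\<Sum>i\<le>degree p. coeff p i * 0)) at_top"
    by (intro tendsto_intros tendsto_power_div_exp_0)
  then show ?thesis
    by (simp add: poly_altdef sum_distrib_right exp_minus divide_inverse mult.assoc)
qed

lemma flat_poly_has_derivative:
  "(flat_poly p has_real_derivative flat_poly ([:0, 0, 1:] * (p - pderiv p)) t) (at t)"
proof -
  consider "t > 0" | "t < 0" | "t = 0" by linarith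
  then show ?thesis
  proof cases
    case 1
    have "((\<lambda>t. poly p (1 / t) * exp (- 1 / t)) has_real_derivative
        flat_poly ([:0, 0, 1:] * (p - pderiv p)) t) (at t)"
      using 1 by (auto intro!: derivative_eq_intros poly_DERIV[THEN DERIV_chain2]
          simp: flat_poly_def field_simps power2_eq_square)
    then show ?thesis
      by (rule has_field_derivative_transform_within_open[where S="{0<..}"])
        (use 1 in \<open>auto simp: flat_poly_def\<close>)
  next
    case 2
    have "((\<lambda>t. 0) has_real_derivative flat_poly ([:0, 0, 1:] * (p - pderiv p)) t) (at t)"
      using 2 by (simp add: flat_poly_def)
    then show ?thesis
      by (rule has_field_derivative_transform_within_open[where S="{..<0}"])
        (use 2 in \<open>auto simp: flat_poly_def\<close>)
  next
    case 3
    have "((\<lambda>h. flat_poly p h / h) \<longlongrightarrow> 0) (at_right 0)"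
    proof (rule Lim_transform_eventually)
      have "((\<lambda>h::real. poly (pCons 0 p) (inverse h) * exp (- inverse h)) \<longlongrightarrow> 0) (at_right 0)"
        by (rule filterlim_compose[OF poly_times_exp_tendsto_0 filterlim_inverse_at_top_right])
      then show "((\<lambda>h::real. poly (pCons 0 p) (inverse h) * exp (- inverse h)) \<longlongrightarrow> 0) (at_right 0)" .
      show "\<forall>\<^sub>F h in at_right 0. poly (pCons 0 p) (inverse h) * exp (- inverse h) = flat_poly p h / h"
        by (auto simp: eventually_at_filter flat_poly_def field_simps)
    qed
    moreover have "((\<lambda>h. flat_poly p h / h) \<longlongrightarrow> 0) (at_left 0)"
      by (rule Lim_transform_eventually[OF tendsto_const])
        (auto simp: eventually_at_filter flat_poly_def)
    ultimately have "((\<lambda>h. flat_poly p h / h) \<longlongrightarrow> 0) (at 0)"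
      by (simp add: filterlim_at_split)
    then show ?thesis
      using 3 by (simp add: DERIV_def flat_poly_def)
  qed
qed

lemma smooth_flat: "smooth flat"
proof -
  have "Ck k (flat_poly p)" for k p
  proof (induction k arbitrary: p)
    case 0
    then show ?case
      using flat_poly_has_derivative by (auto intro!: DERIV_isCont continuous_at_imp_continuous_on)
  next
    case (Suc k)
    then show ?case using flat_poly_has_derivative by auto
  qed
  moreover have "flat = flat_poly 1" by (auto simp: flat_def flat_poly_def)
  ultimately show ?thesis unfolding smooth_def by metis
qed

lemma flat_nonneg: "flat t \<ge> 0" and flat_pos: "t > 0 \<Longrightarrow> flat t > 0"
  and flat_zero: "t \<le> 0 \<Longrightarrow> flat t = 0" and flat_le: "flat t \<le> 1"
  by (auto simp: flat_def)

text \<open>A smooth function that is positive exactly on the interval from \<open>a\<close> to \<open>b\<close>. If \<open>b \<le> a\<close>, it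
  vanishes identically.\<close>

definition bump :: "real \<Rightarrow> real \<Rightarrow> real \<Rightarrow> real" where
  "bump a b x = flat (x - a) * flat (b - x)"

lemma smooth_bump: "smooth (bump a b)"
proof -
  have "smooth (\<lambda>x. flat (1 * x + (- a)) * flat ((- 1) * x + b))"
    by (intro smooth_mult smooth_affine smooth_flat)
  then show ?thesis by (simp add: bump_def[abs_def] algebra_simps)
qed

lemma bump_nonneg: "bump a b x \<ge> 0" by (simp add: bump_def flat_nonneg)
lemma bump_pos: "a < x \<Longrightarrow> x < b \<Longrightarrow> bump a b x > 0" by (simp add: bump_def flat_pos)
lemma bump_zero: "x \<notin> {a<..<b} \<Longrightarrow> bump a b x = 0" by (auto simp: bump_def flat_zero)

lemma deriv_zero_outside:
  assumes "\<And>x. x \<notin> {a..b} \<Longrightarrow> f x = 0" "x \<notin> {a..b::real}"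
  shows "deriv f x = (0::real)"
proof -
  have "((\<lambda>x. 0) has_real_derivative 0) (at x)" by simp
  then have "(f has_real_derivative 0) (at x)"
    by (rule has_field_derivative_transform_within_open[where S="- {a..b}"]) (use assms in auto)
  then show ?thesis by (rule DERIV_imp_deriv)
qed

lemma flat_mono: "s \<le> t \<Longrightarrow> flat s \<le> flat t"
  by (auto simp: flat_def frac_le)

lemma bump_ge:
  assumes "0 \<le> \<delta>" "a + \<delta> \<le> x" "x \<le> b - \<delta>"
  shows "(flat \<delta>)\<^sup>2 \<le> bump a b x"
  unfolding bump_def power2_eq_square
  using assms by (intro mult_mono flat_mono flat_nonneg) auto

lemma bump_le_1: "bump a b x \<le> 1"
  unfolding bump_def by (intro mult_le_one flat_le flat_nonneg)

text \<open>A smooth bounded step whose derivative is a bump around \<open>0\<close>.\<close>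

lemma smooth_step:
  obtains S B where "smooth S" "\<And>x. (S has_real_derivative bump (-1) 1 x) (at x)"
    "\<And>x. 0 \<le> S x" "\<And>x. S x \<le> B"
proof -
  have "\<exists>F. \<forall>x :: real. - \<infinity> < ereal x \<longrightarrow> ereal x < \<infinity> \<longrightarrow> (F has_vector_derivative bump (-1) 1 x) (at x)"
    by (rule einterval_antiderivative)
      (use smooth_continuous[OF smooth_bump] in \<open>auto simp: continuous_on_eq_continuous_at\<close>)
  then obtain F where F: "\<And>x. (F has_real_derivative bump (-1) 1 x) (at x)"
    by (auto simp: has_real_derivative_iff_has_vector_derivative)
  have mono: "F x \<le> F y" if "x \<le> y" for x y
    using that by (rule DERIV_nonneg_imp_nondecreasing) (use F bump_nonneg in blast)
  have const: "F x = F y" if xy: "x < y" "y \<le> -1 \<or> 1 \<le> x" for x y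
  proof -
    obtain z where "x < z" "z < y" "F y - F x = (y - x) * bump (-1) 1 z"
      using MVT2[OF xy(1)] F by metis
    moreover from this have "bump (-1) 1 z = 0" using xy(2) by (intro bump_zero) auto
    ultimately show ?thesis by simp
  qed
  define S where "S x = F x - F (-1)" for x
  have D: "(S has_real_derivative bump (-1) 1 x) (at x)" for x
    unfolding S_def[abs_def] using DERIV_diff[OF F DERIV_const] by simp
  show ?thesis
  proof (rule that)
    show "smooth S" by (rule smooth_antiderivative[OF smooth_bump D])
    show "0 \<le> S x" for x
      using mono[of "-1" x] const[of x "-1"] by (cases "x < -1") (auto simp: S_def)
    show "S x \<le> F 1 - F (-1)" for x
      using mono[of x 1] const[of 1 x] by (cases "1 < x") (auto simp: S_def)
  qed (rule D)
qed

section \<open>Test functions of product form\<close>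

lemma tensor_has_derivative:
  fixes a b :: "real \<Rightarrow> real"
  assumes "(a has_real_derivative a') (at (z $ 1))" "(b has_real_derivative b') (at (z $ 2))"
  shows "((\<lambda>z::real^2. a (z $ 1) * b (z $ 2)) has_derivative
           (\<lambda>v. a' * b (z $ 2) * v $ 1 + a (z $ 1) * b' * v $ 2)) (at z)"
proof -
  have 1: "((\<lambda>z. z $ i) has_derivative (\<lambda>v. v $ i)) (at z)" for i :: 2
    by (intro bounded_linear_imp_has_derivative bounded_linear_vec_nth)
  have "((\<lambda>z::real^2. a (z $ 1)) has_derivative (\<lambda>v. a' * v $ 1)) (at z)"
    using has_derivative_compose[OF 1 assms(1)[unfolded has_field_derivative_def]] .
  moreover have "((\<lambda>z::real^2. b (z $ 2)) has_derivative (\<lambda>v. b' * v $ 2)) (at z)"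
    using has_derivative_compose[OF 1 assms(2)[unfolded has_field_derivative_def]] .
  ultimately show ?thesis
    by (auto intro!: derivative_eq_intros simp: algebra_simps)
qed

lemma partial_deriv_tensor:
  assumes "smooth a" "smooth b"
  shows "partial_deriv i (\<lambda>z. a (z $ 1) * b (z $ 2)) =
    (if i = 1 then (\<lambda>z. deriv a (z $ 1) * b (z $ 2)) else (\<lambda>z. a (z $ 1) * deriv b (z $ 2)))"
proof
  fix z :: "real^2"
  have "frechet_derivative (\<lambda>z::real^2. a (z $ 1) * b (z $ 2)) (at z) =
     (\<lambda>v. deriv a (z $ 1) * b (z $ 2) * v $ 1 + a (z $ 1) * deriv b (z $ 2) * v $ 2)"
    by (intro frechet_derivative_at[symmetric] tensor_has_derivative smooth_has_derivative assms)
  then show "partial_deriv i (\<lambda>z. a (z $ 1) * b (z $ 2)) z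
    = (if i = 1 then (\<lambda>z. deriv a (z $ 1) * b (z $ 2)) else (\<lambda>z. a (z $ 1) * deriv b (z $ 2))) z"
    using exhaust_2[of i] by (auto simp: partial_deriv_def axis_def)
qed

lemma continuous_on_nth_comp:
  fixes f :: "real \<Rightarrow> real"
  assumes "continuous_on UNIV f"
  shows "continuous_on UNIV (\<lambda>z::real^2. f (z $ i))"
  by (rule continuous_on_compose2[OF assms]) (intro continuous_intros, simp)

lemma C_times_tensor:
  "smooth a \<Longrightarrow> smooth b \<Longrightarrow> C_times k (\<lambda>z. a (z $ 1) * b (z $ 2))"
proof (induction k arbitrary: a b)
  case 0
  have *: "continuous_on UNIV (\<lambda>z::real^2. f (z $ i))" if "smooth f" for f i
    using that by (intro continuous_on_nth_comp smooth_continuous)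
  show ?case by (simp add: continuous_on_mult * 0)
next
  case (Suc k)
  then show ?case
    using tensor_has_derivative[OF smooth_has_derivative[OF Suc.prems(1)] smooth_has_derivative[OF Suc.prems(2)]]
    by (auto simp: partial_deriv_tensor smooth_deriv intro: differentiableI)
qed

lemma test_function_tensor:
  fixes \<Omega> :: "(real^2) set"
  assumes "smooth a" "smooth b"
    and "\<And>x. x \<notin> {l $ 1..r $ 1} \<Longrightarrow> a x = 0" "\<And>x. x \<notin> {l $ 2..r $ 2} \<Longrightarrow> b x = 0"
    and "cbox l r \<subseteq> \<Omega>"
  shows "test_function \<Omega> (\<lambda>z. a (z $ 1) * b (z $ 2))"
proof -
  have "{z. a (z $ 1) * b (z $ 2) \<noteq> 0} \<subseteq> cbox l r"
    using assms(3,4) by (auto simp: mem_box_cart forall_2) (metis atLeastAtMost_iff)+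
  then have "closure {z. a (z $ 1) * b (z $ 2) \<noteq> 0} \<subseteq> cbox l r"
    by (rule closure_minimal) (rule closed_cbox)
  moreover from this have "compact (closure {z::real^2. a (z $ 1) * b (z $ 2) \<noteq> 0})"
    by (meson bounded_cbox bounded_subset closed_closure compact_eq_bounded_closed)
  ultimately show ?thesis
    using assms(5) C_times_tensor[OF assms(1,2)]
    unfolding test_function_def by blast
qed

section \<open>Integration along lines parallel to the axes\<close>

text \<open>The point whose coordinate \<open>i\<close> is \<open>t\<close> and whose other coordinate is \<open>c\<close>. Thus \<open>line i c\<close>
  parametrises a line in direction \<open>i\<close>, and \<open>line 2 a b\<close> is the point with coordinates \<open>(a, b)\<close>.\<close>

definition line :: "2 \<Rightarrow> real \<Rightarrow> real \<Rightarrow> real^2" where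
  "line i c t = (\<chi> j. if j = i then t else c)"

lemma line_nth: "line i c t $ j = (if j = i then t else c)"
  by (simp add: line_def)

lemma has_derivative_line: "(line i c has_derivative (\<lambda>h. h *\<^sub>R axis i 1)) (at t)"
proof -
  have "line i c = (\<lambda>t. line i c 0 + t *\<^sub>R axis i 1)"
    by (auto simp: fun_eq_iff vec_eq_iff line_nth axis_def)
  moreover have "((\<lambda>t. line i c 0 + t *\<^sub>R axis i 1) has_derivative (\<lambda>h. h *\<^sub>R axis i 1)) (at t)"
    by (auto intro!: derivative_eq_intros)
  ultimately show ?thesis by simp
qed

lemma continuous_on_line: "continuous_on A (line i c)"
  by (rule continuous_at_imp_continuous_on) (auto intro: has_derivative_continuous has_derivative_line)

lemma measurable_line[measurable]:
  "(\<lambda>(c, t). line i c t) \<in> borel_measurable (borel \<Otimes>\<^sub>M borel)"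
proof -
  have "continuous_on UNIV (\<lambda>p. line i (fst p) (snd p))"
    unfolding line_def
  proof (rule continuous_on_vec_lambda)
    show "continuous_on UNIV (\<lambda>p. if j = i then snd p else fst p)" for j
      by (cases "j = i") (auto intro: continuous_intros)
  qed
  then show ?thesis
    by (simp add: borel_prod case_prod_beta borel_measurable_continuous_onI)
qed

lemma measurable_line_comp[measurable]:
  assumes "f \<in> borel_measurable M" "g \<in> borel_measurable M"
  shows "(\<lambda>z. line i (f z) (g z)) \<in> borel_measurable M"
  using measurable_compose[OF measurable_Pair[OF assms] measurable_line] by simp

lemma norm_line_le: "norm (line 2 a b) \<le> \<bar>a\<bar> + \<bar>b\<bar>"
  using norm_le_l1_cart[of "line 2 a b"] by (simp add: sum_2 line_nth)

lemma measurable_vec_nth[measurable]: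
  fixes f :: "'a \<Rightarrow> real^'n"
  assumes "f \<in> borel_measurable M"
  shows "(\<lambda>x. f x $ i) \<in> borel_measurable M"
  by (rule measurable_compose[OF assms]) (intro borel_measurable_continuous_onI continuous_intros)

text \<open>Lebesgue measure on the plane as a product measure, which makes Fubini available with either
  variable as the inner one.\<close>

lemma lborel_line:
  "distr (lborel \<Otimes>\<^sub>M lborel) borel (\<lambda>(c, t). line i c t) = (lborel :: (real^2) measure)"
proof (rule lborel_eqI[symmetric])
  fix l u :: "real^2" assume *: "\<And>b. b \<in> Basis \<Longrightarrow> l \<bullet> b \<le> u \<bullet> b"
  have le: "l $ j \<le> u $ j" for j
    using *[of "axis j 1"] by (simp add: inner_axis axis_in_Basis_iff)
  \<comment> \<open>\<open>k\<close> is the index different from \<open>i\<close>.\<close>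
  obtain k :: 2 where k: "k \<noteq> i" and U: "(UNIV :: 2 set) = {i, k}"
  proof (cases "i = 1")
    case True
    then show ?thesis using that[of 2] by (simp add: UNIV_2)
  next
    case False
    then have "i = 2" using exhaust_2 by blast
    then show ?thesis using that[of 1] by (simp add: UNIV_2 insert_commute)
  qed
  have all: "(\<forall>j. P j) \<longleftrightarrow> P i \<and> P k" for P
    using U by (metis UNIV_I insertE singletonD)
  have "(\<lambda>(c, t). line i c t) -` box l u \<inter> space (lborel \<Otimes>\<^sub>M lborel) = {l $ k<..<u $ k} \<times> {l $ i<..<u $ i}"
    using k by (auto simp: mem_box_cart line_nth space_pair_measure all)
  then have "emeasure (distr (lborel \<Otimes>\<^sub>M lborel) borel (\<lambda>(c, t). line i c t)) (box l u)
     = emeasure (lborel \<Otimes>\<^sub>M lborel) ({l $ k<..<u $ k} \<times> {l $ i<..<u $ i})"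
    by (subst emeasure_distr) auto
  also have "\<dots> = ennreal (u $ k - l $ k) * ennreal (u $ i - l $ i)"
    by (subst lborel.emeasure_pair_measure_Times) (auto simp: le)
  also have "\<dots> = (\<Prod>b\<in>Basis. (u - l) \<bullet> b)"
  proof -
    have "(Basis :: (real^2) set) = (\<lambda>j. axis j 1) ` UNIV"
      by (auto simp: Basis_vec_def)
    then have "(\<Prod>b\<in>Basis. (u - l) \<bullet> b) = (\<Prod>b\<in>(\<lambda>j. axis j 1) ` UNIV. (u - l) \<bullet> b)"
      by simp
    also have "\<dots> = (\<Prod>j\<in>UNIV. (u - l) $ j)"
      by (subst prod.reindex) (auto simp: inj_on_def axis_eq_axis inner_axis)
    finally have "(\<Prod>b\<in>Basis. (u - l) \<bullet> b) = (\<Prod>j\<in>UNIV. (u - l) $ j)" .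
    also have "\<dots> = (u $ k - l $ k) * (u $ i - l $ i)"
      unfolding U using k by simp
    finally show ?thesis using le by (simp add: ennreal_mult)
  qed
  finally show "emeasure (distr (lborel \<Otimes>\<^sub>M lborel) borel (\<lambda>(c, t). line i c t)) (box l u)
     = (\<Prod>b\<in>Basis. (u - l) \<bullet> b)" .
qed auto

lemma nn_integral_line:
  fixes f :: "real^2 \<Rightarrow> ennreal"
  assumes [measurable]: "f \<in> borel_measurable borel"
  shows "(\<integral>\<^sup>+z. f z \<partial>lborel) = (\<integral>\<^sup>+c. \<integral>\<^sup>+t. f (line i c t) \<partial>lborel \<partial>lborel)"
proof -
  have "(\<integral>\<^sup>+z. f z \<partial>lborel) = (\<integral>\<^sup>+p. f ((\<lambda>(c, t). line i c t) p) \<partial>(lborel \<Otimes>\<^sub>M lborel))"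
    unfolding lborel_line[of i, symmetric] by (subst nn_integral_distr) auto
  also have "\<dots> = (\<integral>\<^sup>+c. \<integral>\<^sup>+t. f (line i c t) \<partial>lborel \<partial>lborel)"
    by (subst lborel.nn_integral_fst[symmetric]) auto
  finally show ?thesis .
qed

lemma integral_line:
  fixes f :: "real^2 \<Rightarrow> real"
  assumes f: "integrable lborel f"
  shows "integral\<^sup>L lborel f = (\<integral>c. \<integral>t. f (line i c t) \<partial>lborel \<partial>lborel)"
    and "AE c in lborel. integrable lborel (\<lambda>t. f (line i c t))"
proof -
  have [measurable]: "f \<in> borel_measurable borel" using f by auto
  have int: "integrable (lborel \<Otimes>\<^sub>M lborel) (\<lambda>p. f ((\<lambda>(c, t). line i c t) p))"
    using f unfolding lborel_line[of i, symmetric] by (subst (asm) integrable_distr_eq) auto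
  have "integral\<^sup>L lborel f = (\<integral>p. f ((\<lambda>(c, t). line i c t) p) \<partial>(lborel \<Otimes>\<^sub>M lborel))"
    unfolding lborel_line[of i, symmetric] by (subst integral_distr) auto
  also have "\<dots> = (\<integral>c. \<integral>t. f (line i c t) \<partial>lborel \<partial>lborel)"
    using lborel_pair.integral_fst'[OF int] by simp
  finally show "integral\<^sup>L lborel f = (\<integral>c. \<integral>t. f (line i c t) \<partial>lborel \<partial>lborel)" .
  show "AE c in lborel. integrable lborel (\<lambda>t. f (line i c t))"
    using lborel_pair.AE_integrable_fst'[OF int] by simp
qed

text \<open>A partial derivative with compact support has integral zero. It is enough that \<open>w\<close> is
  continuous on almost every line in direction \<open>i\<close> and has there the derivative \<open>d\<close> outside a finite
  set.\<close>

lemma integral_partial_eq_0: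
  fixes w d :: "real^2 \<Rightarrow> real"
  assumes d: "integrable lborel d"
    and lines: "AE c in lborel. \<exists>S. finite S \<and> continuous_on UNIV (\<lambda>t. w (line i c t)) \<and>
       (\<forall>t. t \<notin> S \<longrightarrow> ((\<lambda>t. w (line i c t)) has_real_derivative d (line i c t)) (at t))"
    and supp: "\<And>z. norm z \<ge> R \<Longrightarrow> w z = 0 \<and> d z = 0"
  shows "integral\<^sup>L lborel d = 0"
proof -
  have "AE c in lborel. (\<integral>t. d (line i c t) \<partial>lborel) = 0"
    using lines integral_line(2)[OF d, of i]
  proof eventually_elim
    case (elim c)
    then obtain S where S: "finite S" "continuous_on UNIV (\<lambda>t. w (line i c t))"
      "\<And>t. t \<notin> S \<Longrightarrow> ((\<lambda>t. w (line i c t)) has_real_derivative d (line i c t)) (at t)" by blast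
    define r where "r = \<bar>R\<bar>"
    have big: "w (line i c t) = 0 \<and> d (line i c t) = 0" if "\<bar>t\<bar> \<ge> r" for t
      using component_le_norm_cart[of "line i c t" i] that
      by (intro supp) (auto simp: line_nth r_def)
    have "((\<lambda>t. d (line i c t)) has_integral (w (line i c r) - w (line i c (- r)))) {-r..r}"
      by (rule fundamental_theorem_of_calculus_interior_strong[OF S(1)])
        (use S in \<open>auto simp: r_def has_real_derivative_iff_has_vector_derivative[symmetric] intro: continuous_on_subset\<close>)
    then have "((\<lambda>t. d (line i c t)) has_integral 0) {-r..r}"
      using big[of r] big[of "-r"] by (simp add: r_def)
    then have "((\<lambda>t. d (line i c t)) has_integral 0) UNIV"
      by (rule has_integral_on_superset) (use big in force)+
    moreover have "((\<lambda>t. d (line i c t)) has_integral (\<integral>t. d (line i c t) \<partial>lborel)) UNIV"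
      using elim(2) by (rule has_integral_integral_lborel)
    ultimately show ?case by (rule has_integral_unique[symmetric])
  qed
  then have "(\<integral>c. \<integral>t. d (line i c t) \<partial>lborel \<partial>lborel) = (\<integral>c. 0 \<partial>(lborel :: real measure))"
    by (intro integral_cong_AE) (use d in auto)
  then show ?thesis using integral_line(1)[OF d, of i] by simp
qed

section \<open>Test functions and local integrability\<close>

lemma test_functionD:
  assumes "test_function \<Omega> \<phi>"
  shows "\<phi> differentiable (at x)" "continuous_on UNIV \<phi>" "continuous_on UNIV (partial_deriv i \<phi>)"
    "((\<lambda>t. \<phi> (line i c t)) has_real_derivative partial_deriv i \<phi> (line i c t)) (at t)"
    "x \<notin> closure {x. \<phi> x \<noteq> 0} \<Longrightarrow> \<phi> x = 0"
    "x \<notin> closure {x. \<phi> x \<noteq> 0} \<Longrightarrow> partial_deriv i \<phi> x = 0"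
    "x \<notin> \<Omega> \<Longrightarrow> \<phi> x = 0" "x \<notin> \<Omega> \<Longrightarrow> partial_deriv i \<phi> x = 0"
    "compact (closure {x. \<phi> x \<noteq> 0})" "closure {x. \<phi> x \<noteq> 0} \<subseteq> \<Omega>"
proof -
  show diff: "\<phi> differentiable (at x)" for x
    using assms unfolding test_function_def by (metis C_times.simps(2))
  show "continuous_on UNIV \<phi>" "continuous_on UNIV (partial_deriv i \<phi>)" for i
    using assms unfolding test_function_def by (metis C_times.simps)+
  show "((\<lambda>t. \<phi> (line i c t)) has_real_derivative partial_deriv i \<phi> (line i c t)) (at t)"
  proof -
    have D: "(\<phi> has_derivative frechet_derivative \<phi> (at x)) (at x)" for x
      using diff frechet_derivative_works by blast
    then have lin: "linear (frechet_derivative \<phi> (at x))" for x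
      by (rule has_derivative_linear)
    have "((\<lambda>t. \<phi> (line i c t)) has_derivative
        (\<lambda>h. frechet_derivative \<phi> (at (line i c t)) (h *\<^sub>R axis i 1))) (at t)"
      by (rule has_derivative_compose[OF has_derivative_line D])
    then show ?thesis
      by (simp add: has_field_derivative_def partial_deriv_def linear_cmul[OF lin] mult.commute[of _ "_ :: real"] mult_commute_abs)
  qed
  show 5: "x \<notin> closure {x. \<phi> x \<noteq> 0} \<Longrightarrow> \<phi> x = 0" for x
    using closure_subset[of "{x. \<phi> x \<noteq> 0}"] by blast
  show 6: "x \<notin> closure {x. \<phi> x \<noteq> 0} \<Longrightarrow> partial_deriv i \<phi> x = 0" for x
  proof -
    assume x: "x \<notin> closure {x. \<phi> x \<noteq> 0}"
    have "open (- closure {x. \<phi> x \<noteq> 0})" "x \<in> - closure {x. \<phi> x \<noteq> 0}"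
      using x by (simp_all add: open_Compl)
    moreover have "\<And>y. y \<in> - closure {x. \<phi> x \<noteq> 0} \<Longrightarrow> 0 = \<phi> y" using 5 by (metis ComplD)
    ultimately have "(\<phi> has_derivative (\<lambda>h. 0)) (at x)"
      by (rule has_derivative_transform_within_open[OF has_derivative_const])
    then show ?thesis
      unfolding partial_deriv_def by (simp add: frechet_derivative_at[symmetric])
  qed
  show "compact (closure {x. \<phi> x \<noteq> 0})" and s: "closure {x. \<phi> x \<noteq> 0} \<subseteq> \<Omega>"
    using assms by (auto simp: test_function_def)
  show "x \<notin> \<Omega> \<Longrightarrow> \<phi> x = 0" using 5 s by blast
  show "x \<notin> \<Omega> \<Longrightarrow> partial_deriv i \<phi> x = 0" using 6 s by blast
qed

lemma compact_support_bounded: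
  fixes f :: "'a::metric_space \<Rightarrow> real"
  assumes "continuous_on UNIV f" "compact K" "\<And>x. x \<notin> K \<Longrightarrow> f x = 0"
  obtains B where "B \<ge> 0" "\<And>x. \<bar>f x\<bar> \<le> B"
proof -
  have "compact (f ` K)"
    using assms by (intro compact_continuous_image) (auto intro: continuous_on_subset)
  then obtain B where "\<And>y. y \<in> f ` K \<Longrightarrow> norm y \<le> B"
    using compact_imp_bounded bounded_iff by metis
  then have "\<bar>f x\<bar> \<le> max B 0" for x
    using assms(3)[of x] by (cases "x \<in> K") force+
  then show ?thesis using that[of "max B 0"] by auto
qed

lemma integral_lebesgue_on_eq:
  fixes f :: "real^2 \<Rightarrow> real"
  assumes "\<Omega> \<in> sets lebesgue" "f \<in> borel_measurable borel" "\<And>z. z \<notin> \<Omega> \<Longrightarrow> f z = 0"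
  shows "integral\<^sup>L (lebesgue_on \<Omega>) f = integral\<^sup>L lborel f"
    and "integrable (lebesgue_on \<Omega>) f \<longleftrightarrow> integrable lborel f"
proof -
  have *: "(\<lambda>x. indicator \<Omega> x *\<^sub>R f x) = f" using assms(3) by (auto simp: fun_eq_iff indicator_def)
  show "integral\<^sup>L (lebesgue_on \<Omega>) f = integral\<^sup>L lborel f"
    using assms * by (subst integral_restrict_space) (auto simp del: real_scaleR_def simp: integral_completion)
  show "integrable (lebesgue_on \<Omega>) f \<longleftrightarrow> integrable lborel f"
    using assms * by (subst integrable_restrict_space) (auto simp del: real_scaleR_def simp: integrable_completion)
qed

lemma in_LpI:
  fixes f :: "real^2 \<Rightarrow> 'b::euclidean_space"
  assumes [measurable]: "\<Omega> \<in> sets borel" "f \<in> borel_measurable borel"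
    and fin: "(\<integral>\<^sup>+z. ennreal (norm (f z) powr p) * indicator \<Omega> z \<partial>lborel) < \<infinity>"
  shows "in_Lp p \<Omega> f"
proof -
  have \<Omega>: "\<Omega> \<in> sets lebesgue" using assms(1) by (simp add: sets_completionI_sets)
  have "f \<in> borel_measurable (lebesgue_on \<Omega>)"
    by (intro measurable_restrict_space1 measurable_completion) simp
  moreover have "integrable lborel (\<lambda>z. indicator \<Omega> z *\<^sub>R norm (f z) powr p)"
  proof (rule integrableI_nonneg)
    have "(\<integral>\<^sup>+z. ennreal (indicator \<Omega> z *\<^sub>R norm (f z) powr p) \<partial>lborel) =
        (\<integral>\<^sup>+z. ennreal (norm (f z) powr p) * indicator \<Omega> z \<partial>lborel)"
      by (intro nn_integral_cong) (auto simp: indicator_def)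
    then show "(\<integral>\<^sup>+z. ennreal (indicator \<Omega> z *\<^sub>R norm (f z) powr p) \<partial>lborel) < \<infinity>"
      using fin by simp
  qed auto
  then have "integrable lebesgue (\<lambda>z. indicator \<Omega> z *\<^sub>R norm (f z) powr p)"
    by (subst integrable_completion) auto
  then have "integrable (lebesgue_on \<Omega>) (\<lambda>z. norm (f z) powr p)"
    using \<Omega> by (subst integrable_restrict_space) auto
  ultimately show ?thesis by (simp add: in_Lp_def)
qed

lemma in_Lp_locI:
  fixes f :: "real^2 \<Rightarrow> 'b::euclidean_space"
  assumes [measurable]: "f \<in> borel_measurable borel"
    and "\<And>C. compact C \<Longrightarrow> C \<subseteq> \<Omega> \<Longrightarrow> (\<integral>\<^sup>+z. ennreal (norm (f z)) * indicator C z \<partial>lborel) < \<infinity>"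
  shows "in_Lp_loc 1 \<Omega> f"
  unfolding in_Lp_loc_def using assms(2) by (auto intro!: in_LpI borel_compact)

lemma in_Lp_loc_bound:
  fixes f :: "real^2 \<Rightarrow> 'b::euclidean_space"
  assumes [measurable]: "f \<in> borel_measurable borel"
    and bd: "\<And>z. norm (f z) \<le> g z"
    and g: "\<And>C. compact C \<Longrightarrow> (\<integral>\<^sup>+z. ennreal (g z) * indicator C z \<partial>lborel) < \<infinity>"
  shows "in_Lp_loc 1 \<Omega> f"
proof (rule in_Lp_locI)
  fix C :: "(real^2) set" assume "compact C"
  have "(\<integral>\<^sup>+z. ennreal (norm (f z)) * indicator C z \<partial>lborel) \<le> (\<integral>\<^sup>+z. ennreal (g z) * indicator C z \<partial>lborel)"
    by (intro nn_integral_mono mult_right_mono ennreal_leI bd) simp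
  also have "\<dots> < \<infinity>" by (rule g) fact
  finally show "(\<integral>\<^sup>+z. ennreal (norm (f z)) * indicator C z \<partial>lborel) < \<infinity>" .
qed fact

lemma in_Lp_loc_continuous:
  fixes f :: "real^2 \<Rightarrow> 'b::euclidean_space"
  assumes f: "continuous_on UNIV f"
  shows "in_Lp_loc 1 \<Omega> f"
proof (rule in_Lp_locI)
  show [measurable]: "f \<in> borel_measurable borel" using f by (rule borel_measurable_continuous_onI)
  fix C :: "(real^2) set" assume C: "compact C"
  then have [measurable]: "C \<in> sets borel" by (rule borel_compact)
  have "compact (f ` C)" using f C by (intro compact_continuous_image continuous_on_subset[OF f]) auto
  then obtain B where B: "\<And>y. y \<in> f ` C \<Longrightarrow> norm y \<le> B" using compact_imp_bounded bounded_iff by metis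
  have "(\<integral>\<^sup>+z. ennreal (norm (f z)) * indicator C z \<partial>lborel) \<le> (\<integral>\<^sup>+z. ennreal B * indicator C z \<partial>lborel)"
    using B by (intro nn_integral_mono) (auto simp: indicator_def intro: ennreal_leI)
  also have "\<dots> < \<infinity>" using emeasure_compact_finite[OF C] by (simp add: nn_integral_cmult ennreal_mult_less_top)
  finally show "(\<integral>\<^sup>+z. ennreal (norm (f z)) * indicator C z \<partial>lborel) < \<infinity>" .
qed

text \<open>Completeness of Lebesgue measure is used here: \<open>g\<close> is not assumed to be measurable.\<close>

lemma in_Lp_AE:
  fixes f g :: "real^2 \<Rightarrow> 'b::euclidean_space"
  assumes \<Omega>: "\<Omega> \<in> sets lebesgue" and f: "in_Lp p \<Omega> f" and AE: "AE z in lebesgue_on \<Omega>. f z = g z"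
  shows "in_Lp p \<Omega> g"
proof -
  have AE': "AE z in lebesgue. z \<in> \<Omega> \<longrightarrow> f z = g z"
    using AE \<Omega> by (subst (asm) AE_restrict_space_iff) auto
  have fm: "f \<in> borel_measurable (lebesgue_on \<Omega>)" and fi: "integrable (lebesgue_on \<Omega>) (\<lambda>x. norm (f x) powr p)"
    using f by (auto simp: in_Lp_def)
  have "(\<lambda>z. if z \<in> \<Omega> then f z else 0) \<in> borel_measurable lebesgue"
    using fm \<Omega> by (simp add: borel_measurable_if)
  then have "(\<lambda>z. if z \<in> \<Omega> then g z else 0) \<in> borel_measurable lebesgue"
    by (rule borel_measurable_AE) (use AE' in eventually_elim, auto)
  then have gm: "g \<in> borel_measurable (lebesgue_on \<Omega>)"
    using \<Omega> by (simp add: borel_measurable_if)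
  have "integrable (lebesgue_on \<Omega>) (\<lambda>x. norm (g x) powr p)"
  proof (rule integrable_cong_AE_imp[OF fi])
    show "(\<lambda>x. norm (g x) powr p) \<in> borel_measurable (lebesgue_on \<Omega>)" using gm by measurable
    show "AE x in lebesgue_on \<Omega>. norm (f x) powr p = norm (g x) powr p" using AE by eventually_elim simp
  qed
  then show ?thesis using gm by (simp add: in_Lp_def)
qed

lemma in_Lp_1D:
  fixes f :: "real^2 \<Rightarrow> 'b::euclidean_space"
  assumes "in_Lp 1 K f"
  shows "integrable (lebesgue_on K) f"
  using assms unfolding in_Lp_def by (auto intro: Bochner_Integration.integrable_bound)

lemma integrable_loc_mult:
  fixes f :: "real^2 \<Rightarrow> real"
  assumes f: "in_Lp_loc 1 \<Omega> f" and K: "compact K" "K \<subseteq> \<Omega>" and \<Omega>: "\<Omega> \<in> sets lebesgue"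
    and \<psi>: "continuous_on UNIV \<psi>" "\<And>x. x \<notin> K \<Longrightarrow> \<psi> x = 0"
  shows "integrable (lebesgue_on \<Omega>) (\<lambda>x. f x * \<psi> x)"
proof -
  obtain B where B: "B \<ge> 0" "\<And>x. \<bar>\<psi> x\<bar> \<le> B"
    using compact_support_bounded[OF \<psi>(1) K(1) \<psi>(2)] by blast
  have KL: "K \<in> sets lebesgue" using K(1) by (simp add: lmeasurable_compact fmeasurableD)
  have "integrable (lebesgue_on K) f" using f K by (auto simp: in_Lp_loc_def intro: in_Lp_1D)
  then have 1: "integrable lebesgue (\<lambda>x. indicator K x *\<^sub>R f x)"
    using KL by (subst (asm) integrable_restrict_space) auto
  have "integrable lebesgue (\<lambda>x. B * \<bar>indicator K x *\<^sub>R f x\<bar>)"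
    using 1 by (intro integrable_mult_right integrable_abs)
  then have "integrable lebesgue (\<lambda>x. (indicator K x *\<^sub>R f x) * \<psi> x)"
  proof (rule Bochner_Integration.integrable_bound)
    have "\<psi> \<in> borel_measurable lebesgue"
      using \<psi>(1) by (intro measurable_completion) (simp add: borel_measurable_continuous_onI)
    then show "(\<lambda>x. (indicator K x *\<^sub>R f x) * \<psi> x) \<in> borel_measurable lebesgue"
      using 1 by (intro borel_measurable_times) auto
    have "\<bar>f x\<bar> * \<bar>\<psi> x\<bar> \<le> B * \<bar>f x\<bar>" for x
      using B(2)[of x] by (simp add: mult.commute mult_right_mono)
    then show "AE x in lebesgue. norm ((indicator K x *\<^sub>R f x) * \<psi> x) \<le> norm (B * \<bar>indicator K x *\<^sub>R f x\<bar>)"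
      using B(1) by (auto simp: indicator_def abs_mult)
  qed
  moreover have "(\<lambda>x. (indicator K x *\<^sub>R f x) * \<psi> x) = (\<lambda>x. indicator \<Omega> x *\<^sub>R (f x * \<psi> x))"
    using K(2) \<psi>(2) by (force simp: fun_eq_iff indicator_def)
  ultimately show ?thesis using \<Omega> by (subst integrable_restrict_space) auto
qed

lemma integral_loc_mult_bound:
  fixes f \<psi> :: "real^2 \<Rightarrow> real"
  assumes f: "in_Lp_loc 1 UNIV f" and K: "compact K"
    and \<psi>: "continuous_on UNIV \<psi>" "\<And>z. z \<notin> K \<Longrightarrow> \<psi> z = 0" "\<And>z. \<bar>\<psi> z\<bar> \<le> B"
  shows "\<bar>\<integral>z. f z * \<psi> z \<partial>lebesgue\<bar> \<le> B * (\<integral>z. \<bar>f z\<bar> \<partial>(lebesgue_on K))"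
proof -
  have KL: "K \<in> sets lebesgue" using K by (simp add: lmeasurable_compact fmeasurableD)
  have i1: "integrable lebesgue (\<lambda>z. f z * \<psi> z)"
    using integrable_loc_mult[OF f K subset_UNIV _ \<psi>(1,2)] by (simp add: lebesgue_on_UNIV_eq)
  have "integrable (lebesgue_on K) f" using f K by (auto simp: in_Lp_loc_def intro: in_Lp_1D)
  then have "integrable (lebesgue_on K) (\<lambda>z. \<bar>f z\<bar>)" by (rule integrable_abs)
  then have i2: "integrable lebesgue (\<lambda>z. indicator K z *\<^sub>R \<bar>f z\<bar>)"
    using KL by (subst (asm) integrable_restrict_space) auto
  have "\<bar>\<integral>z. f z * \<psi> z \<partial>lebesgue\<bar> \<le> (\<integral>z. \<bar>f z * \<psi> z\<bar> \<partial>lebesgue)" by (rule integral_abs_bound)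
  also have "\<dots> \<le> (\<integral>z. B * (indicator K z *\<^sub>R \<bar>f z\<bar>) \<partial>lebesgue)"
  proof (rule integral_mono)
    fix z
    have "\<bar>f z\<bar> * \<bar>\<psi> z\<bar> \<le> \<bar>f z\<bar> * B" using \<psi>(3) by (intro mult_left_mono) auto
    then show "\<bar>f z * \<psi> z\<bar> \<le> B * (indicator K z *\<^sub>R \<bar>f z\<bar>)"
      using \<psi>(2)[of z] by (cases "z \<in> K") (auto simp: abs_mult mult.commute)
  qed (rule integrable_abs[OF i1] integrable_mult_right[OF i2])+
  also have "\<dots> = B * (\<integral>z. \<bar>f z\<bar> \<partial>(lebesgue_on K))"
    using KL by (subst integral_restrict_space) auto
  finally show ?thesis .
qed

lemma in_Lp_loc_component:
  fixes G :: "real^2 \<Rightarrow> real^2"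
  assumes "in_Lp_loc 1 \<Omega> G"
  shows "in_Lp_loc 1 \<Omega> (\<lambda>z. G z $ i)"
  unfolding in_Lp_loc_def
proof (intro allI impI)
  fix C assume "compact C \<and> C \<subseteq> \<Omega>"
  then have "in_Lp 1 C G" using assms by (auto simp: in_Lp_loc_def)
  then have "integrable (lebesgue_on C) G" by (rule in_Lp_1D)
  then have *: "integrable (lebesgue_on C) (\<lambda>z. G z \<bullet> axis i 1)" by (rule integrable_inner_left)
  then show "in_Lp 1 C (\<lambda>z. G z $ i)"
    unfolding in_Lp_def by (auto simp: inner_axis)
qed

text \<open>A classical gradient that exists on almost every line parallel to an axis, up to finitely many points
  of that line, is a weak gradient as soon as the function is continuous along these lines and
  everything is locally integrable.\<close>

lemma has_weak_gradientI:
  fixes \<Omega> :: "(real^2) set"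
  assumes \<Omega>: "open \<Omega>" and [measurable]: "u \<in> borel_measurable borel" "G \<in> borel_measurable borel"
    and u: "in_Lp_loc 1 \<Omega> u" and G: "in_Lp_loc 1 \<Omega> G"
    and lines: "\<And>i. AE c in lborel. \<exists>S. finite S \<and> continuous_on {t. line i c t \<in> \<Omega>} (\<lambda>t. u (line i c t)) \<and>
       (\<forall>t. line i c t \<in> \<Omega> \<longrightarrow> t \<notin> S \<longrightarrow> ((\<lambda>t. u (line i c t)) has_real_derivative G (line i c t) $ i) (at t))"
  shows "has_weak_gradient \<Omega> u G"
  unfolding has_weak_gradient_def
proof (intro conjI allI impI u G)
  fix \<phi> i assume \<phi>: "test_function \<Omega> \<phi>"
  note T = test_functionD[OF \<phi>]
  let ?K = "closure {x. \<phi> x \<noteq> 0}"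
  let ?a = "\<lambda>z. u z * partial_deriv i \<phi> z" and ?b = "\<lambda>z. G z $ i * \<phi> z"
  have [measurable]: "\<phi> \<in> borel_measurable borel" "partial_deriv i \<phi> \<in> borel_measurable borel"
    using T(2,3) by (auto intro: borel_measurable_continuous_onI)
  have \<Omega>L: "\<Omega> \<in> sets lebesgue" using \<Omega> by simp
  have "integrable (lebesgue_on \<Omega>) ?a"
    by (rule integrable_loc_mult[OF u T(9) T(10) \<Omega>L T(3) T(6)])
  moreover have "integrable (lebesgue_on \<Omega>) ?b"
    by (rule integrable_loc_mult[OF in_Lp_loc_component[OF G] T(9) T(10) \<Omega>L T(2) T(5)])
  ultimately have int: "integrable lborel ?a" "integrable lborel ?b"
    using T(7,8) \<Omega>L by (auto simp: integral_lebesgue_on_eq(2))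
  obtain R where R: "\<And>x. x \<in> ?K \<Longrightarrow> norm x \<le> R"
    using compact_imp_bounded[OF T(9)] bounded_iff by metis
  have "integral\<^sup>L lborel (\<lambda>z. ?a z + ?b z) = 0"
  proof (rule integral_partial_eq_0[where w="\<lambda>z. u z * \<phi> z" and i=i and R="R + 1"])
    show "integrable lborel (\<lambda>z. ?a z + ?b z)" using int by simp
    show "u z * \<phi> z = 0 \<and> ?a z + ?b z = 0" if "R + 1 \<le> norm z" for z
      using T(5,6)[of z] R[of z] that by force
    show "AE c in lborel. \<exists>S. finite S \<and> continuous_on UNIV (\<lambda>t. u (line i c t) * \<phi> (line i c t)) \<and>
       (\<forall>t. t \<notin> S \<longrightarrow> ((\<lambda>t. u (line i c t) * \<phi> (line i c t)) has_real_derivative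
           ?a (line i c t) + ?b (line i c t)) (at t))"
      using lines[of i]
    proof eventually_elim
      case (elim c)
      then obtain S where S: "finite S" "continuous_on {t. line i c t \<in> \<Omega>} (\<lambda>t. u (line i c t))"
        "\<And>t. line i c t \<in> \<Omega> \<Longrightarrow> t \<notin> S \<Longrightarrow> ((\<lambda>t. u (line i c t)) has_real_derivative G (line i c t) $ i) (at t)"
        by blast
      have op: "open {t. line i c t \<in> A}" if "open A" for A
        using open_vimage[OF that continuous_on_line[of UNIV i c]] by (simp add: vimage_def)
      have out: "((\<lambda>t. u (line i c t) * \<phi> (line i c t)) has_real_derivative
           ?a (line i c t) + ?b (line i c t)) (at t)" if t: "line i c t \<notin> \<Omega>" for t
      proof -
        have tK: "line i c t \<notin> ?K" using t T(10) by blast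
        have "((\<lambda>t. 0) has_real_derivative 0) (at t)" by simp
        moreover have "open {t. line i c t \<in> - ?K}"
          by (rule op) (simp add: open_Compl)
        moreover have "t \<in> {t. line i c t \<in> - ?K}" using tK by simp
        moreover have "0 = u (line i c t) * \<phi> (line i c t)" if "t \<in> {t. line i c t \<in> - ?K}" for t
          using that T(5) by (metis ComplD mem_Collect_eq mult_zero_right)
        ultimately have "((\<lambda>t. u (line i c t) * \<phi> (line i c t)) has_real_derivative 0) (at t)"
          by (rule has_field_derivative_transform_within_open)
        then show ?thesis using t by (simp add: T(7,8))
      qed
      have ins: "((\<lambda>t. u (line i c t) * \<phi> (line i c t)) has_real_derivative
           ?a (line i c t) + ?b (line i c t)) (at t)" if t: "line i c t \<in> \<Omega>" "t \<notin> S" for t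
        using DERIV_mult[OF S(3)[OF t] T(4)] by (simp add: algebra_simps)
      have "isCont (\<lambda>t. u (line i c t) * \<phi> (line i c t)) t" for t
      proof (cases "line i c t \<in> \<Omega>")
        case True
        then have "isCont (\<lambda>t. u (line i c t)) t"
          using S(2) op[OF \<Omega>] by (simp add: continuous_on_eq_continuous_at)
        then show ?thesis using DERIV_isCont[OF T(4)] by (intro isCont_mult)
      next
        case False
        then show ?thesis using out DERIV_isCont by blast
      qed
      then show ?case
        using S(1) ins out by (intro exI[of _ S]) (auto simp: continuous_at_imp_continuous_on)
    qed
  qed
  then have "integral\<^sup>L lborel ?a = - integral\<^sup>L lborel ?b"
    using int by simp
  then show "integral\<^sup>L (lebesgue_on \<Omega>) ?a = - integral\<^sup>L (lebesgue_on \<Omega>) ?b"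
    using T(7,8) \<Omega>L by (subst (1 2) integral_lebesgue_on_eq) auto
qed

section \<open>Uniqueness of weak gradients\<close>

lemma bump_approximates_indicator:
  "(\<lambda>n. 1 - exp (- (real n * bump a b x))) \<longlonglongrightarrow> indicator {a<..<b} x"
proof (cases "x \<in> {a<..<b}")
  case True
  then have "bump a b x > 0" by (simp add: bump_pos)
  then have "(\<lambda>n. exp (- (real n * bump a b x))) \<longlonglongrightarrow> 0" by real_asymp
  then have "(\<lambda>n. 1 - exp (- (real n * bump a b x))) \<longlonglongrightarrow> 1 - 0" by (intro tendsto_intros)
  then show ?thesis using True by simp
next
  case False
  then show ?thesis using bump_zero[OF False] by (simp only:) simp
qed

lemma smooth_one_minus_exp_bump: "smooth (\<lambda>x. 1 - exp (- (c * bump a b x)))"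
proof -
  have "smooth (\<lambda>x. 1 + (-1) * exp ((- c) * bump a b x))"
    by (intro smooth_add smooth_mult smooth_exp smooth_const smooth_bump)
  then show ?thesis by simp
qed

lemma integral_lebesgue_AE_eq:
  fixes f g :: "real^2 \<Rightarrow> real"
  assumes "f \<in> borel_measurable lebesgue" "g \<in> borel_measurable borel" "AE z in lborel. f z = g z"
  shows "integral\<^sup>L lebesgue f = integral\<^sup>L lborel g"
    and "integrable lebesgue f \<longleftrightarrow> integrable lborel g"
proof -
  have g: "g \<in> borel_measurable lborel" and g': "g \<in> borel_measurable lebesgue"
    using assms(2) by (auto intro: measurable_completion)
  have AE: "AE z in lebesgue. f z = g z" using assms(3) by (rule AE_completion)
  have "integral\<^sup>L lebesgue f = integral\<^sup>L lebesgue g"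
    by (rule integral_cong_AE[OF assms(1) g' AE])
  then show "integral\<^sup>L lebesgue f = integral\<^sup>L lborel g"
    using integral_completion[OF g] by simp
  have "integrable lebesgue f \<longleftrightarrow> integrable lebesgue g"
    by (rule integrable_cong_AE[OF assms(1) g' AE])
  then show "integrable lebesgue f \<longleftrightarrow> integrable lborel g"
    using integrable_completion[OF g] by simp
qed

lemma AE_zero_if_box_integrals_zero:
  fixes h :: "'a::euclidean_space \<Rightarrow> real"
  assumes h: "integrable lborel h" and tot: "integral\<^sup>L lborel h = 0"
    and box: "\<And>a b. (LINT z:box a b|lborel. h z) = 0"
  shows "AE z in lborel. h z = 0"
proof (rule sigma_finite_measure.density_zero[OF sigma_finite_lborel h])
  have si: "set_integrable lborel B h" if "B \<in> sets borel" for B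
    unfolding set_integrable_def using that h by (intro integrable_mult_indicator) simp_all
  fix A :: "'a set" assume "A \<in> sets lborel"
  then have A: "A \<in> sigma_sets UNIV (range (\<lambda>(a, b). box a b))"
    by (simp add: borel_eq_box)
  have "Int_stable (range (\<lambda>(a, b). box a b :: 'a set))"
    by (auto simp: Int_stable_def box_Int_box)
  moreover have "range (\<lambda>(a, b). box a b :: 'a set) \<subseteq> Pow UNIV" by simp
  ultimately show "(LINT z:A|lborel. h z) = 0"
    using A
  proof (induction rule: sigma_sets_induct_disjoint)
    case (compl A)
    then have [measurable]: "A \<in> sets borel" by (simp add: borel_eq_box)
    have "set_integrable lborel A h" "set_integrable lborel (UNIV - A) h"
      by (auto intro!: si)
    then have "(LINT z:A \<union> (UNIV - A)|lborel. h z) = (LINT z:A|lborel. h z) + (LINT z:UNIV - A|lborel. h z)"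
      by (intro set_integral_Un) auto
    moreover have "A \<union> (UNIV - A) = UNIV" by auto
    ultimately show ?case using tot compl by (simp add: set_lebesgue_integral_def)
  next
    case (union A)
    then have A: "\<And>i. A i \<in> sets lborel" by (auto simp: borel_eq_box)
    have "(LINT z:(\<Union>i. A i)|lborel. h z) = (\<Sum>i. (LINT z:A i|lborel. h z))"
    proof (rule lebesgue_integral_countable_add)
      show "set_integrable lborel (\<Union>i. A i) h"
        using A by (intro si) auto
    qed (use A union in \<open>auto simp: disjoint_family_on_def\<close>)
    then show ?case using union by simp
  qed (use box in \<open>auto simp: set_lebesgue_integral_def\<close>)
qed

text \<open>The fundamental lemma of the calculus of variations. The functions \<open>1 - exp (- n b)\<close>, with \<open>b\<close> a bump,
  are smooth, have the support of the bump and increase to the indicator of an open interval; their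
  products show that the integral of \<open>f\<close> over every small box is zero.\<close>

lemma fundamental_lemma:
  fixes f :: "real^2 \<Rightarrow> real"
  assumes \<Omega>: "open \<Omega>" and f: "in_Lp_loc 1 \<Omega> f"
    and zero: "\<And>\<phi>. test_function \<Omega> \<phi> \<Longrightarrow> integral\<^sup>L (lebesgue_on \<Omega>) (\<lambda>z. f z * \<phi> z) = 0"
  shows "AE z in lebesgue_on \<Omega>. f z = 0"
proof -
  have boxes: "AE z in lebesgue. z \<in> cbox l r \<longrightarrow> f z = 0" if sub: "cbox l r \<subseteq> \<Omega>" for l r
  proof -
    \<comment> \<open>A Borel function \<open>g\<close> replaces \<open>f\<close> on the closed box.\<close>
    define g0 where "g0 z = indicator (cbox l r) z *\<^sub>R f z" for z
    have "integrable (lebesgue_on (cbox l r)) f"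
      using f sub by (intro in_Lp_1D) (auto simp: in_Lp_loc_def)
    then have g0: "integrable lebesgue g0"
      unfolding g0_def by (subst (asm) integrable_restrict_space) auto
    obtain g where gm: "g \<in> borel_measurable lborel" and gAE: "AE z in lborel. g0 z = g z"
      using completion_ex_borel_measurable_real[of g0 lborel] g0 by auto
    then have gb[measurable]: "g \<in> borel_measurable borel" by simp
    have g: "integrable lborel g"
      using integral_lebesgue_AE_eq(2)[OF borel_measurable_integrable[OF g0] gb gAE] g0 by simp
    define h where "h z = indicator (box l r) z * g z" for z
    have h: "integrable lborel h"
      using integrable_mult_indicator[OF _ g, of "box l r"] by (simp add: h_def[abs_def])
    have hbox: "(LINT z:box a b|lborel. h z) = 0" for a b
    proof -
      \<comment> \<open>The corners of \<open>box a b \<inter> box l r\<close>; if the boxes are disjoint, one of the bumps below vanishes.\<close>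
      define a' b' where "a' = (\<chi> i. max (a $ i) (l $ i))" and "b' = (\<chi> i. min (b $ i) (r $ i))"
      define \<alpha> where "\<alpha> n i t = 1 - exp (- (real n * bump (a' $ i) (b' $ i) t))" for n :: nat and i :: 2 and t
      define \<phi> where "\<phi> n z = \<alpha> n 1 (z $ 1) * \<alpha> n 2 (z $ 2)" for n :: nat and z :: "real^2"
      have \<alpha>: "smooth (\<alpha> n i)" for n i
        unfolding \<alpha>_def[abs_def] by (rule smooth_one_minus_exp_bump)
      have out: "\<alpha> n i t = 0" if "t \<notin> {l $ i..r $ i}" for n i t
        using that by (auto simp: \<alpha>_def a'_def b'_def bump_zero)
      have \<alpha>01: "0 \<le> \<alpha> n i t \<and> \<alpha> n i t \<le> 1" for n i t
        by (simp add: \<alpha>_def bump_nonneg)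
      have \<phi>: "test_function \<Omega> (\<phi> n)" for n
        unfolding \<phi>_def[abs_def] by (rule test_function_tensor[OF \<alpha> \<alpha> out out sub])
      have \<phi>m[measurable]: "\<phi> n \<in> borel_measurable borel" for n
        using test_functionD(2)[OF \<phi>] by (rule borel_measurable_continuous_onI)
      have \<phi>0: "\<phi> n z = 0" if "z \<notin> cbox l r" for n z
        using that out[of "z $ 1" 1] out[of "z $ 2" 2] by (auto simp: \<phi>_def mem_box_cart forall_2)
      have "(\<integral>z. g z * \<phi> n z \<partial>lborel) = 0" for n
      proof -
        have "0 = (\<integral>z. f z * \<phi> n z \<partial>(lebesgue_on \<Omega>))" using zero[OF \<phi>] by simp
        also have "\<dots> = (\<integral>z. indicator \<Omega> z *\<^sub>R (f z * \<phi> n z) \<partial>lebesgue)"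
          using \<Omega> by (subst integral_restrict_space) auto
        also have "\<dots> = (\<integral>z. g0 z * \<phi> n z \<partial>lebesgue)"
          using \<phi>0 sub by (intro Bochner_Integration.integral_cong) (auto simp: g0_def indicator_def)
        also have "\<dots> = (\<integral>z. g z * \<phi> n z \<partial>lborel)"
        proof (rule integral_lebesgue_AE_eq(1))
          have "\<phi> n \<in> borel_measurable lebesgue" by (intro measurable_completion) simp
          then show "(\<lambda>z. g0 z * \<phi> n z) \<in> borel_measurable lebesgue"
            using borel_measurable_integrable[OF g0] by (rule borel_measurable_times[rotated])
          show "AE z in lborel. g0 z * \<phi> n z = g z * \<phi> n z" using gAE by eventually_elim simp
        qed simp
        finally show ?thesis by simp
      qed
      moreover have "(\<lambda>n. \<integral>z. g z * \<phi> n z \<partial>lborel) \<longlonglongrightarrow> (\<integral>z. g z * indicator (box a' b') z \<partial>lborel)"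
      proof (rule integral_dominated_convergence[where w="\<lambda>z. \<bar>g z\<bar>"])
        have ind: "indicator (box a' b') z = indicator {a' $ 1<..<b' $ 1} (z $ 1) * (indicator {a' $ 2<..<b' $ 2} (z $ 2) :: real)" for z
          by (auto simp: indicator_def mem_box_cart forall_2)
        have "(\<lambda>n. g z * \<phi> n z) \<longlonglongrightarrow> g z * indicator (box a' b') z" for z
          unfolding \<phi>_def \<alpha>_def ind by (intro tendsto_intros bump_approximates_indicator)
        then show "AE z in lborel. (\<lambda>n. g z * \<phi> n z) \<longlonglongrightarrow> g z * indicator (box a' b') z" by simp
        have "\<bar>\<phi> n z\<bar> \<le> 1" for n z
          using \<alpha>01[of n 1 "z $ 1"] \<alpha>01[of n 2 "z $ 2"] by (simp add: \<phi>_def abs_mult mult_le_one)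
        then show "AE z in lborel. norm (g z * \<phi> n z) \<le> \<bar>g z\<bar>" for n
          by (simp add: abs_mult mult_left_le)
      qed (use g in auto)
      ultimately have "(\<integral>z. g z * indicator (box a' b') z \<partial>lborel) = 0"
        by (simp add: LIMSEQ_const_iff)
      moreover have "g z * indicator (box a' b') z = indicator (box a b) z *\<^sub>R h z" for z
        by (auto simp: indicator_def h_def mem_box_cart a'_def b'_def)
      ultimately show ?thesis by (simp add: set_lebesgue_integral_def)
    qed
    have "integral\<^sup>L lborel h = (LINT z:box l r|lborel. h z)"
      unfolding set_lebesgue_integral_def by (intro Bochner_Integration.integral_cong) (auto simp: h_def indicator_def)
    then have "AE z in lborel. h z = 0"
      using hbox by (intro AE_zero_if_box_integrals_zero[OF h]) auto
    then have "AE z in lborel. z \<in> box l r \<longrightarrow> f z = 0"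
      using gAE by eventually_elim (auto simp: h_def g0_def indicator_def box_subset_cbox[THEN subsetD])
    then have 1: "AE z in lebesgue. z \<in> box l r \<longrightarrow> f z = 0" by (rule AE_completion)
    have "AE z in lebesgue. z \<notin> cbox l r - box l r"
      using negligible_frontier_interval[of l r] by (intro AE_not_in) (simp add: negligible_iff_null_sets)
    with 1 show ?thesis by eventually_elim auto
  qed
  obtain \<D> where \<D>: "countable \<D>" "\<D> \<subseteq> Pow \<Omega>" "\<And>X. X \<in> \<D> \<Longrightarrow> \<exists>a b. X = cbox a b" "\<Union>\<D> = \<Omega>"
    using open_countable_Union_open_cbox[OF \<Omega>] by blast
  have "AE z in lebesgue. \<forall>X\<in>\<D>. z \<in> X \<longrightarrow> f z = 0"
    unfolding AE_ball_countable[OF \<D>(1)]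
  proof
    fix X assume X: "X \<in> \<D>"
    then obtain a b where "X = cbox a b" using \<D>(3) by blast
    then show "AE z in lebesgue. z \<in> X \<longrightarrow> f z = 0" using boxes \<D>(2) X by blast
  qed
  then show ?thesis
    using \<Omega> \<D>(4) by (subst AE_restrict_space_iff) auto
qed

lemma weak_gradient_unique:
  assumes \<Omega>: "open \<Omega>" and G: "has_weak_gradient \<Omega> u G" and H: "has_weak_gradient \<Omega> u H"
  shows "AE z in lebesgue_on \<Omega>. G z = H z"
proof -
  have comp: "AE z in lebesgue_on \<Omega>. G z $ i = H z $ i" for i
  proof -
    have loc: "in_Lp_loc 1 \<Omega> (\<lambda>z. G z $ i)" "in_Lp_loc 1 \<Omega> (\<lambda>z. H z $ i)"
      using G H by (auto simp: has_weak_gradient_def intro: in_Lp_loc_component)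
    have "in_Lp_loc 1 \<Omega> (\<lambda>z. G z $ i - H z $ i)"
      unfolding in_Lp_loc_def
    proof (intro allI impI)
      fix C assume "compact C \<and> C \<subseteq> \<Omega>"
      then have "integrable (lebesgue_on C) (\<lambda>z. G z $ i - H z $ i)"
        using loc by (intro Bochner_Integration.integrable_diff in_Lp_1D) (auto simp: in_Lp_loc_def)
      then show "in_Lp 1 C (\<lambda>z. G z $ i - H z $ i)"
        unfolding in_Lp_def by auto
    qed
    then have "AE z in lebesgue_on \<Omega>. G z $ i - H z $ i = 0"
    proof (rule fundamental_lemma[OF \<Omega>])
      fix \<phi> assume \<phi>: "test_function \<Omega> \<phi>"
      note T = test_functionD[OF \<phi>]
      have \<Omega>L: "\<Omega> \<in> sets lebesgue" using \<Omega> by simp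
      have "integrable (lebesgue_on \<Omega>) (\<lambda>z. G z $ i * \<phi> z)"
        by (rule integrable_loc_mult[OF loc(1) T(9) T(10) \<Omega>L T(2) T(5)])
      moreover have "integrable (lebesgue_on \<Omega>) (\<lambda>z. H z $ i * \<phi> z)"
        by (rule integrable_loc_mult[OF loc(2) T(9) T(10) \<Omega>L T(2) T(5)])
      moreover have "integral\<^sup>L (lebesgue_on \<Omega>) (\<lambda>z. G z $ i * \<phi> z) = integral\<^sup>L (lebesgue_on \<Omega>) (\<lambda>z. H z $ i * \<phi> z)"
      proof -
        have "integral\<^sup>L (lebesgue_on \<Omega>) (\<lambda>z. u z * partial_deriv i \<phi> z) = - integral\<^sup>L (lebesgue_on \<Omega>) (\<lambda>z. G z $ i * \<phi> z)"
          "integral\<^sup>L (lebesgue_on \<Omega>) (\<lambda>z. u z * partial_deriv i \<phi> z) = - integral\<^sup>L (lebesgue_on \<Omega>) (\<lambda>z. H z $ i * \<phi> z)"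
          using G H \<phi> unfolding has_weak_gradient_def by blast+
        then show ?thesis by linarith
      qed
      ultimately show "integral\<^sup>L (lebesgue_on \<Omega>) (\<lambda>z. (G z $ i - H z $ i) * \<phi> z) = 0"
        by (simp add: left_diff_distrib)
    qed
    then show ?thesis by simp
  qed
  show ?thesis
    using comp[of 1] comp[of 2] by eventually_elim (simp add: vec_eq_iff forall_2)
qed

lemma weak_gradient_AE_eq:
  assumes "open \<Omega>" "has_weak_gradient \<Omega> u G"
  shows "AE z in lebesgue_on \<Omega>. weak_gradient \<Omega> u z = G z"
  using assms weak_gradient_unique someI[of "has_weak_gradient \<Omega> u" G] unfolding weak_gradient_def by blast

lemma weak_differential_AE_eq:
  assumes "open \<Omega>" "has_weak_differential \<Omega> h A"
  shows "AE z in lebesgue_on \<Omega>. weak_differential \<Omega> h z = A z"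
proof -
  have W: "has_weak_differential \<Omega> h (weak_differential \<Omega> h)"
    unfolding weak_differential_def using assms(2) by (rule someI[of "has_weak_differential \<Omega> h"])
  have "AE z in lebesgue_on \<Omega>. weak_differential \<Omega> h z $ i = A z $ i" for i
    using W assms weak_gradient_unique unfolding has_weak_differential_def by blast
  from this[of 1] this[of 2] show ?thesis
    by eventually_elim (simp add: vec_eq_iff[of "_ :: real^2^2"] forall_2)
qed

section \<open>The homeomorphism between the cusp domain and the disc\<close>

text \<open>Truncation of \<open>y\<close> to the interval \<open>[-c, c]\<close>.\<close>

definition clamp1 :: "real \<Rightarrow> real \<Rightarrow> real" where
  "clamp1 c y = max (- c) (min c y)"

text \<open>For \<open>s \<ge> 0\<close>, the odd piecewise linear map of the line with slope \<open>m\<close> on \<open>[0, s]\<close>, slope \<open>2 - m\<close> on \<open>[s, 2 s]\<close>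
  and slope \<open>1\<close> beyond. It fixes \<open>2 s\<close> and sends \<open>s\<close> to \<open>s m\<close>. For \<open>s = 0\<close> it is the identity.\<close>

definition squeeze1 :: "real \<Rightarrow> real \<Rightarrow> real \<Rightarrow> real" where
  "squeeze1 s m y = y + (1 - m) * clamp1 (2 * s) y - 2 * (1 - m) * clamp1 s y"

text \<open>The inverse of \<^const>\<open>squeeze1\<close> for \<open>s \<ge> 0\<close> and \<open>0 \<le> m < 1\<close>, with \<open>m > 0\<close> if \<open>s > 0\<close>.\<close>

definition stretch1 :: "real \<Rightarrow> real \<Rightarrow> real \<Rightarrow> real" where
  "stretch1 s m y =
     (if \<bar>y\<bar> < s * m then y / m
      else if \<bar>y\<bar> < 2 * s then (2 * s * (1 - m) * sgn y + y) / (2 - m)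
      else y)"

lemma squeeze1_uminus: "0 \<le> s \<Longrightarrow> squeeze1 s m (- y) = - squeeze1 s m y"
proof -
  assume "0 \<le> s"
  then have "clamp1 c (- y) = - clamp1 c y" if "c = s \<or> c = 2 * s" for c
    using that by (auto simp: clamp1_def)
  then show ?thesis by (simp add: squeeze1_def)
qed

lemma stretch1_uminus: "stretch1 s m (- y) = - stretch1 s m y"
  by (simp add: stretch1_def sgn_minus diff_divide_distrib add_divide_distrib)

lemma squeeze1_eq:
  assumes "0 \<le> s" "0 \<le> y"
  shows "squeeze1 s m y = (if y \<le> s then m * y else if y \<le> 2 * s then (2 - m) * y - 2 * s * (1 - m) else y)"
  using assms by (auto simp: squeeze1_def clamp1_def max_def min_def algebra_simps)

lemma squeeze1_stretch1:
  assumes "0 \<le> s" "0 \<le> m" "m < 1" "s > 0 \<Longrightarrow> m > 0"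
  shows "squeeze1 s m (stretch1 s m y) = y"
proof -
  have *: "squeeze1 s m (stretch1 s m y) = y" if y: "0 \<le> y" for y
  proof (cases "y < s * m")
    case True
    then have "s \<noteq> 0" using y by auto
    then have "s > 0" "m > 0" using assms by auto
    then show ?thesis using True y
      by (simp add: stretch1_def squeeze1_eq[OF assms(1)] field_simps)
  next
    case ge: False
    show ?thesis
    proof (cases "y < 2 * s")
      case True
      then have s: "s > 0" and m: "m > 0" using y assms by linarith+
      then have "y > 0" using ge mult_pos_pos[OF s m] by linarith
      define t where "t = (2 * s * (1 - m) + y) / (2 - m)"
      have t: "(2 - m) * t = 2 * s * (1 - m) + y" using assms by (simp add: t_def)
      have "(2 - m) * s \<le> (2 - m) * t" unfolding t using ge by (simp add: algebra_simps)
      then have t1: "s \<le> t" using assms by simp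
      have "(2 - m) * t \<le> (2 - m) * (2 * s)" unfolding t using True by (simp add: algebra_simps)
      then have t2: "t \<le> 2 * s" using assms by simp
      have "stretch1 s m y = t" using \<open>y > 0\<close> ge True by (simp add: stretch1_def t_def)
      moreover have "squeeze1 s m t = y"
      proof (cases "t = s")
        case True
        then show ?thesis using t t1 s by (simp add: squeeze1_eq algebra_simps)
      next
        case False
        then show ?thesis using t t1 t2 s by (simp add: squeeze1_eq)
      qed
      ultimately show ?thesis by simp
    next
      case False
      then have "stretch1 s m y = y" using y ge by (simp add: stretch1_def)
      moreover have "squeeze1 s m y = y"
        using False y assms(1) by (auto simp: squeeze1_eq algebra_simps)
      ultimately show ?thesis by simp
    qed
  qed
  show ?thesis
  proof (cases "0 \<le> y")
    case False
    then have "squeeze1 s m (stretch1 s m (- y)) = - y" using * by simp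
    then show ?thesis using assms(1) by (simp add: stretch1_uminus squeeze1_uminus)
  qed (rule *)
qed

lemma squeeze1_strict_mono:
  assumes "0 \<le> s" "0 \<le> m" "m < 1" "s > 0 \<Longrightarrow> m > 0" "x < y"
  shows "squeeze1 s m x < squeeze1 s m y"
proof -
  have mono: "squeeze1 s m x < squeeze1 s m y" if "0 \<le> x" "x < y" for x y
  proof -
    have lin: "m * x < m * y" if "s > 0" using assms(4)[OF that] \<open>x < y\<close> by simp
    have lin2: "(2 - m) * x < (2 - m) * y" using assms(3) \<open>x < y\<close> by simp
    have a: "m * s < (2 - m) * t - 2 * s * (1 - m)" if "s < t" for t
    proof -
      have "(2 - m) * s < (2 - m) * t" using assms(3) that by simp
      then show ?thesis by (simp add: algebra_simps)
    qed
    have b: "(2 - m) * t - 2 * s * (1 - m) \<le> 2 * s" if "t \<le> 2 * s" for t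
    proof -
      have "(2 - m) * t \<le> (2 - m) * (2 * s)" using assms(3) that by (intro mult_left_mono) auto
      then show ?thesis by (simp add: algebra_simps)
    qed
    have c: "m * x \<le> m * s" if "x \<le> s" using that assms(2) by (rule mult_left_mono)
    have d: "m * s \<le> s" using assms by (simp add: mult_left_le_one_le)
    consider "y \<le> s" | "x \<le> s" "s < y" "y \<le> 2 * s" | "x \<le> s" "y > 2 * s" | "s < x" "y \<le> 2 * s"
      | "s < x" "x \<le> 2 * s" "2 * s < y" | "x > 2 * s" by linarith
    then show ?thesis
    proof cases
      case 1
      then show ?thesis using that assms(1) lin by (simp add: squeeze1_eq)
    next
      case 2
      then show ?thesis using that assms(1) a[of y] c by (simp add: squeeze1_eq)
    next
      case 3
      then show ?thesis using that assms(1) c d by (simp add: squeeze1_eq)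
    next
      case 4
      then show ?thesis using that assms(1) lin2 by (simp add: squeeze1_eq)
    next
      case 5
      then show ?thesis using that assms(1) b[of x] by (simp add: squeeze1_eq)
    next
      case 6
      then show ?thesis using that assms(1) by (simp add: squeeze1_eq)
    qed
  qed
  have z: "squeeze1 s m 0 = 0" using assms(1) by (simp add: squeeze1_eq)
  consider "0 \<le> x" | "x < 0" "0 \<le> y" | "y < 0" by linarith
  then show ?thesis
  proof cases
    case 1
    then show ?thesis using mono assms(5) by blast
  next
    case 2
    then have "0 < squeeze1 s m (- x)" using mono[of 0 "- x"] z by simp
    moreover have "0 \<le> squeeze1 s m y"
      using mono[of 0 y] z 2 by (metis less_eq_real_def)
    ultimately
    show ?thesis using assms(1) by (simp add: squeeze1_uminus)
  next
    case 3
    then have "squeeze1 s m (- y) < squeeze1 s m (- x)"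
      using mono[of "- y" "- x"] assms(5) by simp
    then show ?thesis using assms(1) by (simp add: squeeze1_uminus)
  qed
qed

lemma stretch1_squeeze1:
  assumes "0 \<le> s" "0 \<le> m" "m < 1" "s > 0 \<Longrightarrow> m > 0"
  shows "stretch1 s m (squeeze1 s m y) = y"
  using squeeze1_stretch1[OF assms, of "squeeze1 s m y"] squeeze1_strict_mono[OF assms]
  by (metis linorder_neq_iff)

lemma stretch1_less_iff:
  assumes "0 \<le> s" "0 \<le> m" "m < 1" "s > 0 \<Longrightarrow> m > 0"
  shows "\<bar>stretch1 s m y\<bar> < s \<longleftrightarrow> \<bar>y\<bar> < s * m"
proof -
  have *: "\<bar>stretch1 s m y\<bar> < s \<longleftrightarrow> \<bar>y\<bar> < s * m" if y: "0 \<le> y" for y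
  proof (cases "y < s * m")
    case True
    then have "s \<noteq> 0" using y by auto
    then have "s > 0" "m > 0" using assms by auto
    then show ?thesis using True y by (simp add: stretch1_def field_simps)
  next
    case ge: False
    show ?thesis
    proof (cases "y < 2 * s")
      case True
      then have s: "s > 0" and m: "m > 0" using y assms by linarith+
      then have "y > 0" using ge mult_pos_pos[OF s m] by linarith
      then have "stretch1 s m y = (2 * s * (1 - m) + y) / (2 - m)" using ge True by (simp add: stretch1_def)
      moreover have "s \<le> (2 * s * (1 - m) + y) / (2 - m)"
        using ge assms(3) by (simp add: field_simps)
      ultimately have "s \<le> stretch1 s m y" by simp
      then show ?thesis using ge y by linarith
    next
      case False
      then show ?thesis using ge assms(1) y by (simp add: stretch1_def)
    qed
  qed
  show ?thesis
  proof (cases "0 \<le> y")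
    case False
    then show ?thesis using *[of "- y"] by (simp add: stretch1_uminus)
  qed (rule *)
qed

text \<open>The half-length of the vertical section of the unit disc, extended by \<open>0\<close>.\<close>

definition height :: "real \<Rightarrow> real" where
  "height x = sqrt (max 0 (1 - x\<^sup>2))"

text \<open>The ratio between the sections of the cusp domain and those of the disc.\<close>

definition pinch :: "real \<Rightarrow> real" where
  "pinch x = flat (1 - x\<^sup>2)"

lemma height_nonneg: "0 \<le> height x" by (simp add: height_def)
lemma height_le_1: "height x \<le> 1" by (simp add: height_def)
lemma height_pos_iff: "0 < height x \<longleftrightarrow> \<bar>x\<bar> < 1"
  by (auto simp: height_def abs_square_less_1 less_max_iff_disj)
lemma pinch_nonneg: "0 \<le> pinch x" by (simp add: pinch_def flat_nonneg)
lemma pinch_pos_iff: "0 < pinch x \<longleftrightarrow> \<bar>x\<bar> < 1"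
  by (auto simp: pinch_def flat_def abs_square_less_1)
lemma pinch_less_1: "pinch x < 1" by (simp add: pinch_def flat_def)

lemma height_pinch: "height x > 0 \<Longrightarrow> pinch x > 0" by (simp add: height_pos_iff pinch_pos_iff)

lemma continuous_on_height: "continuous_on UNIV height"
  unfolding height_def[abs_def] by (intro continuous_intros)

lemma continuous_on_pinch: "continuous_on UNIV pinch"
  unfolding pinch_def[abs_def]
  by (rule continuous_on_compose2[OF smooth_continuous[OF smooth_flat]]) (intro continuous_intros, simp)

text \<open>The maps of the plane that act on each vertical line by \<^const>\<open>squeeze1\<close> and \<^const>\<open>stretch1\<close>.
  The map \<open>stretch\<close> opens the cusps and is the homeomorphism of finite distortion.\<close>

definition squeeze :: "real^2 \<Rightarrow> real^2" where
  "squeeze z = line 2 (z $ 1) (squeeze1 (height (z $ 1)) (pinch (z $ 1)) (z $ 2))"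

definition stretch :: "real^2 \<Rightarrow> real^2" where
  "stretch z = line 2 (z $ 1) (stretch1 (height (z $ 1)) (pinch (z $ 1)) (z $ 2))"

lemma line_surj: "line 2 (z $ 1) (z $ 2) = z"
  by (simp add: vec_eq_iff forall_2 line_nth)

lemma squeeze_stretch: "squeeze (stretch z) = z"
  by (simp add: squeeze_def stretch_def line_nth squeeze1_stretch1 height_nonneg pinch_nonneg pinch_less_1 height_pinch line_surj)

lemma stretch_squeeze: "stretch (squeeze z) = z"
  by (simp add: squeeze_def stretch_def line_nth stretch1_squeeze1 height_nonneg pinch_nonneg pinch_less_1 height_pinch line_surj)

lemma continuous_on_squeeze: "continuous_on UNIV squeeze"
proof -
  have [continuous_intros]: "continuous_on UNIV (\<lambda>z::real^2. height (z $ 1))" "continuous_on UNIV (\<lambda>z::real^2. pinch (z $ 1))"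
    using continuous_on_compose2[OF continuous_on_height, of UNIV "\<lambda>z::real^2. z $ 1"]
      continuous_on_compose2[OF continuous_on_pinch, of UNIV "\<lambda>z::real^2. z $ 1"]
    by (simp_all add: continuous_on_component)
  have "continuous_on UNIV (\<lambda>z. squeeze z $ j)" for j
    unfolding squeeze_def line_nth squeeze1_def clamp1_def
    by (cases "j = 2") (simp_all, (intro continuous_intros)+)
  then have "continuous_on UNIV (\<lambda>z. \<chi> j. squeeze z $ j)"
    by (rule continuous_on_vec_lambda)
  then show ?thesis by simp
qed

text \<open>Continuity is evident only for \<^const>\<open>squeeze\<close>; for \<^const>\<open>stretch\<close>, which is delicate at the
  tips of the cusps, it follows from invariance of domain.\<close>

lemma homeomorphism_stretch: "homeomorphism UNIV UNIV stretch squeeze"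
proof -
  have inj: "inj squeeze" using stretch_squeeze by (rule inj_on_inverseI)
  obtain g where g: "homeomorphism UNIV (range squeeze) squeeze g"
    using invariance_of_domain_homeomorphism[OF open_UNIV continuous_on_squeeze _ inj] by auto
  have "g z = stretch z" for z
    using g squeeze_stretch[of z] by (metis UNIV_I homeomorphism_def)
  then have "g = stretch" by auto
  moreover have "range squeeze = UNIV" using squeeze_stretch by (metis surj_def)
  ultimately have "homeomorphism UNIV UNIV squeeze stretch" using g by simp
  then show ?thesis by (rule homeomorphism_symD)
qed

lemma continuous_on_stretch: "continuous_on UNIV stretch"
  using homeomorphism_stretch by (simp add: homeomorphism_def)

text \<open>The domain of the theorem. At points with \<open>\<bar>x\<bar> \<ge> 1\<close> the condition fails, since
  \<^const>\<open>height\<close> vanishes there.\<close>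

definition cusp_domain :: "(real^2) set" where
  "cusp_domain = {z. \<bar>z $ 2\<bar> < height (z $ 1) * pinch (z $ 1)}"

lemma unit_ball_iff: "z \<in> ball 0 1 \<longleftrightarrow> \<bar>z $ 2\<bar> < height (z $ 1)" for z :: "real^2"
proof -
  have "z \<in> ball 0 1 \<longleftrightarrow> (z $ 1)\<^sup>2 + (z $ 2)\<^sup>2 < 1"
    by (simp add: norm_vec_def L2_set_def sum_2)
  also have "\<dots> \<longleftrightarrow> (z $ 2)\<^sup>2 < max 0 (1 - (z $ 1)\<^sup>2)"
    by (auto simp: less_max_iff_disj not_less)
  also have "\<dots> \<longleftrightarrow> \<bar>z $ 2\<bar> < height (z $ 1)"
    unfolding height_def by (metis real_sqrt_abs real_sqrt_less_iff)
  finally show ?thesis .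
qed

lemma stretch_mem_ball: "stretch z \<in> ball 0 1 \<longleftrightarrow> z \<in> cusp_domain"
  by (simp only: unit_ball_iff)
    (simp add: stretch_def line_nth cusp_domain_def stretch1_less_iff height_nonneg pinch_nonneg pinch_less_1 height_pinch)

lemma stretch_image: "stretch ` cusp_domain = ball 0 1"
proof (intro equalityI subsetI)
  fix z assume "z \<in> stretch ` cusp_domain"
  then show "z \<in> ball 0 1" using stretch_mem_ball by blast
next
  fix z assume "z \<in> ball (0 :: real^2) 1"
  then have "stretch (squeeze z) \<in> ball 0 1" by (simp only: stretch_squeeze)
  then have "squeeze z \<in> cusp_domain" by (simp only: stretch_mem_ball)
  then show "z \<in> stretch ` cusp_domain" using stretch_squeeze by (metis imageI)
qed

lemma cusp_domain_eq: "cusp_domain = squeeze ` ball 0 1"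
  unfolding stretch_image[symmetric] image_image squeeze_stretch by simp

lemma homeomorphic_cusp_domain: "ball (0::real^2) 1 homeomorphic cusp_domain"
proof -
  have "homeomorphism (ball 0 1) cusp_domain squeeze stretch"
    by (rule homeomorphism_of_subsets[OF homeomorphism_symD[OF homeomorphism_stretch] subset_UNIV
          subset_UNIV[of UNIV] cusp_domain_eq[symmetric]])
  then show ?thesis unfolding homeomorphic_def by (intro exI)
qed

lemma cusp_domain_props:
  "open cusp_domain" "domain cusp_domain" "bounded cusp_domain" "simply_connected cusp_domain"
proof -
  have eq: "cusp_domain = stretch -` ball 0 1" using stretch_mem_ball by blast
  show op: "open cusp_domain"
    unfolding eq by (rule open_vimage[OF open_ball continuous_on_stretch])
  have "connected cusp_domain" unfolding cusp_domain_eq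
    by (rule connected_continuous_image) (auto intro: continuous_on_subset[OF continuous_on_squeeze])
  moreover have "cusp_domain \<noteq> {}" unfolding cusp_domain_eq by simp
  ultimately show "domain cusp_domain" using op by (simp add: domain_def)
  show "bounded cusp_domain"
  proof (rule bounded_subset)
    show "cusp_domain \<subseteq> ball 0 1"
    proof
      fix z assume "z \<in> cusp_domain"
      moreover have "height (z $ 1) * pinch (z $ 1) \<le> height (z $ 1)"
        using height_nonneg pinch_nonneg pinch_less_1 by (simp add: less_imp_le mult_left_le)
      ultimately show "z \<in> ball 0 1" unfolding unit_ball_iff by (simp add: cusp_domain_def)
    qed
  qed simp
  show "simply_connected cusp_domain"
    using homeomorphic_simply_connected[OF homeomorphic_cusp_domain] convex_imp_simply_connected by blast
qed

section \<open>Distortion of the homeomorphism\<close>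

text \<open>The derivatives of \<^const>\<open>height\<close> and \<^const>\<open>pinch\<close> on \<open>(-1, 1)\<close>.\<close>

definition dheight :: "real \<Rightarrow> real" where
  "dheight x = - x / height x"

definition dpinch :: "real \<Rightarrow> real" where
  "dpinch x = - 2 * x / (1 - x\<^sup>2)\<^sup>2 * pinch x"

lemma height_has_derivative: "\<bar>x\<bar> < 1 \<Longrightarrow> (height has_real_derivative dheight x) (at x)"
proof -
  assume x: "\<bar>x\<bar> < 1"
  then have pos: "0 < 1 - x\<^sup>2" by (simp add: abs_square_less_1)
  then have s: "height x = sqrt (1 - x\<^sup>2)" by (simp add: height_def)
  have "((\<lambda>x. sqrt (1 - x\<^sup>2)) has_real_derivative dheight x) (at x)"
    unfolding dheight_def s using pos by (auto intro!: derivative_eq_intros simp: field_simps)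
  moreover have "open {-1<..<1::real}" "x \<in> {-1<..<1}" using x by auto
  moreover have "sqrt (1 - y\<^sup>2) = height y" if "y \<in> {-1<..<1}" for y
  proof -
    have "y\<^sup>2 < 1" using that by (simp add: abs_square_less_1 abs_less_iff)
    then show ?thesis by (simp add: height_def)
  qed
  ultimately show ?thesis by (rule has_field_derivative_transform_within_open)
qed

lemma pinch_has_derivative: "\<bar>x\<bar> < 1 \<Longrightarrow> (pinch has_real_derivative dpinch x) (at x)"
proof -
  assume x: "\<bar>x\<bar> < 1"
  then have pos: "0 < 1 - x\<^sup>2" by (simp add: abs_square_less_1)
  then have s: "pinch x = exp (- 1 / (1 - x\<^sup>2))" by (simp add: pinch_def flat_def)
  have "((\<lambda>x. exp (- 1 / (1 - x\<^sup>2))) has_real_derivative dpinch x) (at x)"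
    unfolding dpinch_def s using pos by (auto intro!: derivative_eq_intros simp: field_simps power2_eq_square)
  moreover have "open {-1<..<1::real}" "x \<in> {-1<..<1}" using x by auto
  moreover have "exp (- 1 / (1 - y\<^sup>2)) = pinch y" if "y \<in> {-1<..<1}" for y
  proof -
    have "y\<^sup>2 < 1" using that by (simp add: abs_square_less_1 abs_less_iff)
    then show ?thesis by (simp add: pinch_def flat_def)
  qed
  ultimately show ?thesis by (rule has_field_derivative_transform_within_open)
qed

lemma dheight_bound: "\<bar>dheight x\<bar> \<le> 1 / height x"
proof (cases "\<bar>x\<bar> < 1")
  case True
  then show ?thesis using height_nonneg[of x] by (simp add: dheight_def divide_right_mono)
next
  case False
  then have "height x = 0" using height_pos_iff[of x] height_nonneg[of x] by linarith
  then show ?thesis by (simp add: dheight_def)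
qed

lemma dpinch_bound: "\<bar>dpinch x\<bar> \<le> 4"
proof (cases "\<bar>x\<bar> < 1")
  case True
  define t where "t = 1 / (1 - x\<^sup>2)"
  have pos: "0 < 1 - x\<^sup>2" using True by (simp add: abs_square_less_1)
  then have t: "t > 0" by (simp add: t_def)
  \<comment> \<open>The factor \<open>(1 - x\<^sup>2)\<^sup>-\<^sup>2\<close> is absorbed by the exponential.\<close>
  have "t\<^sup>2 / 2 \<le> exp t" using exp_lower_Taylor_quadratic[of t] t by simp
  then have "t\<^sup>2 * exp (- t) \<le> 2" by (simp add: exp_minus field_simps)
  moreover have "\<bar>dpinch x\<bar> = 2 * \<bar>x\<bar> * (t\<^sup>2 * exp (- t))"
    using pos by (simp add: dpinch_def pinch_def flat_def t_def abs_mult power_divide)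
  moreover have "2 * \<bar>x\<bar> * (t\<^sup>2 * exp (- t)) \<le> 2 * 1 * (t\<^sup>2 * exp (- t))"
    using True by (intro mult_right_mono mult_left_mono) auto
  ultimately show ?thesis by linarith
next
  case False
  then have "pinch x = 0" using pinch_pos_iff[of x] pinch_nonneg[of x] by linarith
  then show ?thesis by (simp add: dpinch_def)
qed

lemma finite_level_set:
  assumes inj: "\<And>x y. 0 \<le> x \<Longrightarrow> x < y \<Longrightarrow> y < 1 \<Longrightarrow> f y < f x"
    and even: "\<And>x. f (- x) = f x" and zero: "\<And>x. \<bar>x\<bar> \<ge> 1 \<Longrightarrow> f x = 0" and c: "c \<noteq> (0::real)"
  shows "finite {x::real. f x = c}"
proof (cases "{x. f x = c} = {}")
  case False
  then obtain a where a: "f a = c" by auto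
  have f: "f \<bar>x\<bar> = f x" for x using even[of x] by (auto simp: abs_if)
  have "x \<in> {a, - a}" if x: "f x = c" for x
  proof -
    have "\<bar>x\<bar> < 1" using zero[of x] x c by force
    moreover have "\<bar>a\<bar> < 1" using zero[of a] a c by force
    ultimately
    have "\<bar>x\<bar> = \<bar>a\<bar>"
      using inj[of "\<bar>x\<bar>" "\<bar>a\<bar>"] inj[of "\<bar>a\<bar>" "\<bar>x\<bar>"] a x f by (metis abs_ge_zero less_irrefl linorder_neq_iff)
    then show ?thesis by auto
  qed
  then have "{x. f x = c} \<subseteq> {a, - a}" by auto
  then show ?thesis by (rule finite_subset) simp
qed auto

lemma height_strict: "0 \<le> x \<Longrightarrow> x < y \<Longrightarrow> y < 1 \<Longrightarrow> height y < height x"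
  by (simp add: height_def less_max_iff_disj) (smt (verit) power_strict_mono one_power2 zero_less_numeral pos2)

lemma pinch_strict:
  assumes "0 \<le> x" "x < y" "y < 1" shows "pinch y < pinch x"
proof -
  have 1: "x\<^sup>2 < y\<^sup>2" using assms by (intro power_strict_mono) auto
  have 2: "y\<^sup>2 < 1" using assms by (simp add: abs_square_less_1)
  have "1 / (1 - x\<^sup>2) < 1 / (1 - y\<^sup>2)" using 1 2 by (intro divide_strict_left_mono) auto
  then show ?thesis using 1 2 by (simp add: pinch_def flat_def)
qed

text \<open>These level sets are the points where a horizontal line can cross the curves along which
  \<^const>\<open>stretch\<close> may fail to be differentiable.\<close>

lemma finite_level_sets:
  assumes "c \<noteq> 0"
  shows "finite {x. height x * pinch x = c}" "finite {x. 2 * height x = c}"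
proof -
  have z: "height x = 0" if "\<bar>x\<bar> \<ge> 1" for x
    using height_pos_iff[of x] height_nonneg[of x] that by linarith
  show "finite {x. 2 * height x = c}"
    by (rule finite_level_set[where f="\<lambda>x. 2 * height x", OF _ _ _ assms]) (auto simp: height_strict z, simp add: height_def)
  show "finite {x. height x * pinch x = c}"
  proof (rule finite_level_set[where f="\<lambda>x. height x * pinch x", OF _ _ _ assms])
    fix x y :: real assume xy: "0 \<le> x" "x < y" "y < 1"
    then show "height y * pinch y < height x * pinch x"
      using height_strict[OF xy] pinch_strict[OF xy] height_nonneg pinch_nonneg by (intro mult_strict_mono') auto
  qed (auto simp: z, simp add: height_def pinch_def)
qed

text \<open>The partial derivatives of the second component of \<^const>\<open>stretch\<close>, with
  the formula of the outer region on the curves that separate the regions.\<close>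

definition stretch_dy :: "real^2 \<Rightarrow> real" where
  "stretch_dy z = (if \<bar>z $ 2\<bar> < height (z $ 1) * pinch (z $ 1) then 1 / pinch (z $ 1)
     else if \<bar>z $ 2\<bar> < 2 * height (z $ 1) then 1 / (2 - pinch (z $ 1)) else 1)"

definition stretch_dx :: "real^2 \<Rightarrow> real" where
  "stretch_dx z = (if \<bar>z $ 2\<bar> < height (z $ 1) * pinch (z $ 1) then - z $ 2 * dpinch (z $ 1) / (pinch (z $ 1))\<^sup>2
     else if \<bar>z $ 2\<bar> < 2 * height (z $ 1) then
       (sgn (z $ 2) * (2 * dheight (z $ 1) * (1 - pinch (z $ 1)) - 2 * height (z $ 1) * dpinch (z $ 1)) * (2 - pinch (z $ 1))
        + (2 * height (z $ 1) * (1 - pinch (z $ 1)) * sgn (z $ 2) + z $ 2) * dpinch (z $ 1)) / (2 - pinch (z $ 1))\<^sup>2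
     else 0)"

lemma height_pinch_le: "height x * pinch x \<le> height x"
  using height_nonneg[of x] pinch_nonneg[of x] pinch_less_1[of x] by (simp add: mult_left_le)

lemma height_pos_of_less:
  "\<bar>y\<bar> < height x * pinch x \<Longrightarrow> \<bar>x\<bar> < 1" "\<bar>y\<bar> < 2 * height x \<Longrightarrow> \<bar>x\<bar> < 1"
  using height_pinch_le[of x] height_pos_iff[of x] by linarith+

lemma stretch_line_y:
  "\<exists>S. finite S \<and> (\<forall>t. t \<notin> S \<longrightarrow>
     ((\<lambda>t. stretch1 (height c) (pinch c) t) has_real_derivative stretch_dy (line 2 c t)) (at t))"
proof (intro exI conjI allI impI)
  let ?S = "{0, height c * pinch c, - (height c * pinch c), 2 * height c, - (2 * height c)}"
  show "finite ?S" by simp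
  fix t assume t: "t \<notin> ?S"
  note le = height_pinch_le[of c] and s0 = height_nonneg[of c]
  consider "\<bar>t\<bar> < height c * pinch c" | "height c * pinch c < \<bar>t\<bar>" "\<bar>t\<bar> < 2 * height c" "t > 0"
    | "height c * pinch c < \<bar>t\<bar>" "\<bar>t\<bar> < 2 * height c" "t < 0" | "2 * height c < \<bar>t\<bar>" "height c * pinch c < \<bar>t\<bar>"
  proof -
    have "\<bar>t\<bar> \<noteq> height c * pinch c" "\<bar>t\<bar> \<noteq> 2 * height c" "t \<noteq> 0"
      using t by (auto simp: abs_if split: if_splits)
    then show ?thesis using that le s0 by (smt (verit))
  qed
  then show "((\<lambda>t. stretch1 (height c) (pinch c) t) has_real_derivative stretch_dy (line 2 c t)) (at t)"
  proof cases
    case 1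
    have "((\<lambda>t. t / pinch c) has_real_derivative 1 / pinch c) (at t)"
      by (rule DERIV_cdivide) (rule DERIV_ident)
    moreover have "open {t. \<bar>t\<bar> < height c * pinch c}" by (intro open_Collect_less continuous_intros)
    ultimately have "((\<lambda>t. stretch1 (height c) (pinch c) t) has_real_derivative 1 / pinch c) (at t)"
      by (rule has_field_derivative_transform_within_open) (use 1 in \<open>auto simp: stretch1_def\<close>)
    then show ?thesis using 1 by (simp add: stretch_dy_def line_nth)
  next
    case 2
    have "((\<lambda>t. (2 * height c * (1 - pinch c) * 1 + t) / (2 - pinch c)) has_real_derivative 1 / (2 - pinch c)) (at t)"
      by (rule DERIV_cdivide) (auto intro!: derivative_eq_intros)
    moreover have "open {t. height c * pinch c < \<bar>t\<bar> \<and> \<bar>t\<bar> < 2 * height c \<and> t > 0}"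
      by (intro open_Collect_conj open_Collect_less continuous_intros)
    ultimately have "((\<lambda>t. stretch1 (height c) (pinch c) t) has_real_derivative 1 / (2 - pinch c)) (at t)"
      by (rule has_field_derivative_transform_within_open) (use 2 in \<open>auto simp: stretch1_def\<close>)
    then show ?thesis using 2 by (simp add: stretch_dy_def line_nth)
  next
    case 3
    have "((\<lambda>t. (2 * height c * (1 - pinch c) * (- 1) + t) / (2 - pinch c)) has_real_derivative 1 / (2 - pinch c)) (at t)"
      by (rule DERIV_cdivide) (auto intro!: derivative_eq_intros)
    moreover have "open {t. height c * pinch c < \<bar>t\<bar> \<and> \<bar>t\<bar> < 2 * height c \<and> t < 0}"
      by (intro open_Collect_conj open_Collect_less continuous_intros)
    ultimately have "((\<lambda>t. stretch1 (height c) (pinch c) t) has_real_derivative 1 / (2 - pinch c)) (at t)"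
      by (rule has_field_derivative_transform_within_open) (use 3 in \<open>auto simp: stretch1_def\<close>)
    then show ?thesis using 3 by (simp add: stretch_dy_def line_nth)
  next
    case 4
    have "((\<lambda>t. t) has_real_derivative 1) (at t)" by simp
    moreover have "open {t. 2 * height c < \<bar>t\<bar> \<and> height c * pinch c < \<bar>t\<bar>}"
      by (intro open_Collect_conj open_Collect_less continuous_intros)
    ultimately have "((\<lambda>t. stretch1 (height c) (pinch c) t) has_real_derivative 1) (at t)"
      by (rule has_field_derivative_transform_within_open) (use 4 in \<open>auto simp: stretch1_def\<close>)
    then show ?thesis using 4 by (simp add: stretch_dy_def line_nth)
  qed
qed

text \<open>The line through the tips, \<open>c = 0\<close>, is left out.\<close>

lemma stretch_line_x:
  assumes c: "c \<noteq> 0"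
  shows "\<exists>S. finite S \<and> (\<forall>t. t \<notin> S \<longrightarrow>
     ((\<lambda>t. stretch1 (height t) (pinch t) c) has_real_derivative stretch_dx (line 1 c t)) (at t))"
proof (intro exI conjI allI impI)
  let ?S = "{t. height t * pinch t = \<bar>c\<bar>} \<union> {t. 2 * height t = \<bar>c\<bar>}"
  show "finite ?S" using finite_level_sets[of "\<bar>c\<bar>"] c by simp
  fix t assume t: "t \<notin> ?S"
  note ci = continuous_on_height continuous_on_pinch
  consider "\<bar>c\<bar> < height t * pinch t" | "height t * pinch t < \<bar>c\<bar>" "\<bar>c\<bar> < 2 * height t"
    | "2 * height t < \<bar>c\<bar>" "height t * pinch t < \<bar>c\<bar>"
    using t height_pinch_le[of t] height_nonneg[of t] by (auto simp: not_less) linarith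
  then show "((\<lambda>t. stretch1 (height t) (pinch t) c) has_real_derivative stretch_dx (line 1 c t)) (at t)"
  proof cases
    case 1
    note t1 = height_pos_of_less(1)[OF 1]
    have "pinch t > 0" using t1 by (simp add: pinch_pos_iff)
    then have "((\<lambda>t. c / pinch t) has_real_derivative - c * dpinch t / (pinch t)\<^sup>2) (at t)"
      using pinch_has_derivative[OF t1]
      by (auto intro!: derivative_eq_intros simp: power2_eq_square)
    moreover have "open {t. \<bar>c\<bar> < height t * pinch t}" by (intro open_Collect_less continuous_intros ci)
    ultimately have "((\<lambda>t. stretch1 (height t) (pinch t) c) has_real_derivative - c * dpinch t / (pinch t)\<^sup>2) (at t)"
      by (rule has_field_derivative_transform_within_open) (use 1 in \<open>auto simp: stretch1_def\<close>)
    then show ?thesis using 1 by (simp add: stretch_dx_def line_nth)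
  next
    case 2
    note t1 = height_pos_of_less(2)[OF 2(2)]
    let ?d = "(sgn c * (2 * dheight t * (1 - pinch t) - 2 * height t * dpinch t) * (2 - pinch t)
        + (2 * height t * (1 - pinch t) * sgn c + c) * dpinch t) / (2 - pinch t)\<^sup>2"
    have "((\<lambda>t. (2 * height t * (1 - pinch t) * sgn c + c) / (2 - pinch t)) has_real_derivative ?d) (at t)"
      using pinch_has_derivative[OF t1] height_has_derivative[OF t1] pinch_less_1[of t]
      by (auto intro!: derivative_eq_intros simp: power2_eq_square algebra_simps)
    moreover have "open {t. height t * pinch t < \<bar>c\<bar> \<and> \<bar>c\<bar> < 2 * height t}"
      by (intro open_Collect_conj open_Collect_less continuous_intros ci)
    ultimately have "((\<lambda>t. stretch1 (height t) (pinch t) c) has_real_derivative ?d) (at t)"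
      by (rule has_field_derivative_transform_within_open) (use 2 in \<open>auto simp: stretch1_def\<close>)
    then show ?thesis using 2 by (simp add: stretch_dx_def line_nth)
  next
    case 3
    have "((\<lambda>t. c) has_real_derivative 0) (at t)" by simp
    moreover have "open {t. 2 * height t < \<bar>c\<bar> \<and> height t * pinch t < \<bar>c\<bar>}"
      by (intro open_Collect_conj open_Collect_less continuous_intros ci)
    ultimately have "((\<lambda>t. stretch1 (height t) (pinch t) c) has_real_derivative 0) (at t)"
      by (rule has_field_derivative_transform_within_open) (use 3 in \<open>auto simp: stretch1_def\<close>)
    then show ?thesis using 3 by (simp add: stretch_dx_def line_nth)
  qed
qed

lemma stretch_dy_pos: "stretch_dy z > 0"
  using height_pos_of_less(1)[of "z $ 2" "z $ 1"] pinch_pos_iff[of "z $ 1"] pinch_less_1[of "z $ 1"] by (auto simp: stretch_dy_def)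

text \<open>An upper bound for the distortion \<open>\<bar>D\<bar>\<^sup>2 / J\<close>, since \<open>J\<close> is \<^const>\<open>stretch_dy\<close> and
  \<open>\<bar>D\<bar> \<le> 1 + \<bar>stretch_dx\<bar> + stretch_dy\<close>. By the inequality of arithmetic and geometric means it also
  bounds the entries of the differential.\<close>

definition distortion_bound :: "real^2 \<Rightarrow> real" where
  "distortion_bound z = 3 * (1 + (stretch_dx z)\<^sup>2 + (stretch_dy z)\<^sup>2) / stretch_dy z"

lemma distortion_bound_estimates:
  "6 \<le> distortion_bound z" "\<bar>stretch_dx z\<bar> \<le> distortion_bound z"
  "stretch_dy z \<le> distortion_bound z"
  "(1 + \<bar>stretch_dx z\<bar> + stretch_dy z)\<^sup>2 \<le> distortion_bound z * stretch_dy z"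
proof -
  note p = stretch_dy_pos[of z]
  have "0 \<le> (stretch_dy z - 1)\<^sup>2" "0 \<le> (\<bar>stretch_dx z\<bar> - stretch_dy z)\<^sup>2" "0 \<le> (\<bar>stretch_dx z\<bar> - 1)\<^sup>2" by simp_all
  then have 1: "2 * stretch_dy z \<le> (stretch_dy z)\<^sup>2 + 1"
      "2 * (\<bar>stretch_dx z\<bar> * stretch_dy z) \<le> (stretch_dx z)\<^sup>2 + (stretch_dy z)\<^sup>2"
      "2 * \<bar>stretch_dx z\<bar> \<le> (stretch_dx z)\<^sup>2 + 1"
    by (simp_all add: power2_eq_square algebra_simps flip: abs_mult)
  have *: "a \<le> distortion_bound z" if "a * stretch_dy z \<le> 3 * (1 + (stretch_dx z)\<^sup>2 + (stretch_dy z)\<^sup>2)" for a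
    using that p by (simp add: distortion_bound_def pos_le_divide_eq)
  have "6 * stretch_dy z \<le> 3 * (1 + 0 + (stretch_dy z)\<^sup>2)" using 1(1) by simp
  also have "\<dots> \<le> 3 * (1 + (stretch_dx z)\<^sup>2 + (stretch_dy z)\<^sup>2)"
    by (intro mult_left_mono add_mono) simp_all
  finally show "6 \<le> distortion_bound z" by (rule *)
  show "\<bar>stretch_dx z\<bar> \<le> distortion_bound z"
  proof (rule *)
    have "0 \<le> (stretch_dx z)\<^sup>2" "0 \<le> (stretch_dy z)\<^sup>2" by simp_all
    then show "\<bar>stretch_dx z\<bar> * stretch_dy z \<le> 3 * (1 + (stretch_dx z)\<^sup>2 + (stretch_dy z)\<^sup>2)" using 1(2) by argo
  qed
  show "stretch_dy z \<le> distortion_bound z" by (intro *) (simp add: power2_eq_square algebra_simps)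
  have "(1 + \<bar>stretch_dx z\<bar> + stretch_dy z)\<^sup>2 = 1 + (stretch_dx z)\<^sup>2 + (stretch_dy z)\<^sup>2
      + 2 * \<bar>stretch_dx z\<bar> + 2 * stretch_dy z + 2 * (\<bar>stretch_dx z\<bar> * stretch_dy z)"
    by (simp add: power2_eq_square algebra_simps flip: abs_mult)
  also have "\<dots> \<le> 3 * (1 + (stretch_dx z)\<^sup>2 + (stretch_dy z)\<^sup>2)" using 1 by simp
  finally show "(1 + \<bar>stretch_dx z\<bar> + stretch_dy z)\<^sup>2 \<le> distortion_bound z * stretch_dy z" using p by (simp add: distortion_bound_def)
qed

text \<open>The three summands belong to the exterior, to the cusp domain and to the region between the cusp
  domain and the curve \<open>\<bar>y\<bar> = 2 s\<close>. For \<open>\<bar>x\<bar> \<ge> 1\<close> the quotients are \<open>0\<close>.\<close>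

lemma distortion_bound_le:
  "distortion_bound z \<le> 6 + 54 / pinch (z $ 1) * indicator {- (height (z $ 1) * pinch (z $ 1))..height (z $ 1) * pinch (z $ 1)} (z $ 2)
    + 7788 / (height (z $ 1))\<^sup>2 * indicator {- (2 * height (z $ 1))..2 * height (z $ 1)} (z $ 2)"
proof -
  define x y s m where "x = z $ 1" and "y = z $ 2" and "s = height x" and "m = pinch x"
  have s0: "0 \<le> s" "s \<le> 1" and m0: "0 \<le> m" "m < 1"
    by (simp_all add: s_def m_def height_nonneg height_le_1 pinch_nonneg pinch_less_1)
  have dm: "\<bar>dpinch x\<bar> \<le> 4" by (rule dpinch_bound)
  have nn: "0 \<le> 54 / m * indicator {- (s * m)..s * m} y" "0 \<le> 7788 / s\<^sup>2 * indicator {- (2 * s)..2 * s} y"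
    using s0 m0 by simp_all
  consider (I) "\<bar>y\<bar> < s * m" | (II) "\<not> \<bar>y\<bar> < s * m" "\<bar>y\<bar> < 2 * s" | (III) "\<not> \<bar>y\<bar> < s * m" "\<not> \<bar>y\<bar> < 2 * s"
    by blast
  then have "distortion_bound z \<le> 6 + 54 / m * indicator {- (s * m)..s * m} y + 7788 / s\<^sup>2 * indicator {- (2 * s)..2 * s} y"
  proof cases
    case I
    then have m: "m > 0" using m0 by (cases "m = 0") auto
    have y1: "stretch_dy z = 1 / m" and x1: "stretch_dx z = - y * dpinch x / m\<^sup>2"
      using I by (simp_all add: stretch_dy_def stretch_dx_def x_def y_def s_def m_def)
    have "\<bar>y\<bar> \<le> 1 * m" using I s0 m mult_right_mono[of s 1 m] by linarith
    then have "\<bar>y\<bar> * \<bar>dpinch x\<bar> \<le> m * 4" using dm m by (intro mult_mono) auto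
    then have "\<bar>stretch_dx z\<bar> * m \<le> 4" using m by (simp add: x1 abs_mult power2_eq_square field_simps)
    then have "(\<bar>stretch_dx z\<bar> * m)\<^sup>2 \<le> 4\<^sup>2" using m by (intro power_mono) auto
    then have x2: "(stretch_dx z)\<^sup>2 * m\<^sup>2 \<le> 16" by (simp add: power_mult_distrib)
    have m2: "m\<^sup>2 \<le> 1" using m0 by (simp add: power_le_one)
    have "distortion_bound z * m = 3 * (1 * m\<^sup>2 + (stretch_dx z)\<^sup>2 * m\<^sup>2 + 1)" using m by (simp add: distortion_bound_def y1 field_simps power2_eq_square)
    also have "\<dots> \<le> 54" using x2 m2 by simp
    finally have "distortion_bound z \<le> 54 / m" using m by (simp add: pos_le_divide_eq)
    moreover have ind: "indicator {- (s * m)..s * m} y = (1::real)" using I by (simp add: abs_less_iff)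
    ultimately show ?thesis using nn(2) unfolding ind by linarith
  next
    case II
    then have s: "s > 0" by linarith
    have y1: "stretch_dy z = 1 / (2 - m)" and x1: "stretch_dx z =
        (sgn y * (2 * dheight x * (1 - m) - 2 * s * dpinch x) * (2 - m) + (2 * s * (1 - m) * sgn y + y) * dpinch x) / (2 - m)\<^sup>2"
      using II by (simp_all add: stretch_dy_def stretch_dx_def x_def y_def s_def m_def)
    have s1: "s \<le> 1 / s" "1 \<le> 1 / s" using s s0 by (simp_all add: field_simps mult_le_one)
    have sg: "\<bar>sgn y\<bar> \<le> 1" by (simp add: sgn_if)
    have dsb: "\<bar>dheight x\<bar> \<le> 1 / s" unfolding s_def by (rule dheight_bound)
    have "\<bar>dheight x\<bar> * (1 - m) \<le> 1 / s * 1" using dsb m0 s by (intro mult_mono) auto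
    moreover have "s * \<bar>dpinch x\<bar> \<le> 1 * 4" using s0 dm by (intro mult_mono) auto
    moreover have "\<bar>2 * dheight x * (1 - m) - 2 * s * dpinch x\<bar> \<le> 2 * (\<bar>dheight x\<bar> * (1 - m)) + 2 * (s * \<bar>dpinch x\<bar>)"
      using abs_triangle_ineq4[of "2 * dheight x * (1 - m)" "2 * s * dpinch x"] m0 s by (simp add: abs_mult)
    ultimately have "\<bar>2 * dheight x * (1 - m) - 2 * s * dpinch x\<bar> \<le> 10 / s" using s1 by simp
    then have "\<bar>sgn y\<bar> * \<bar>2 * dheight x * (1 - m) - 2 * s * dpinch x\<bar> * (2 - m) \<le> 1 * (10 / s) * 2"
      using sg m0 s by (intro mult_mono) auto
    moreover have "\<bar>(2 * s * (1 - m) * sgn y + y)\<bar> * \<bar>dpinch x\<bar> \<le> (4 / s) * 4"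
    proof (intro mult_mono dm)
      have "s * (1 - m) * \<bar>sgn y\<bar> \<le> s * 1 * 1" using s m0 sg by (intro mult_mono) auto
      moreover have "\<bar>2 * s * (1 - m) * sgn y + y\<bar> \<le> 2 * (s * (1 - m) * \<bar>sgn y\<bar>) + \<bar>y\<bar>"
        using abs_triangle_ineq[of "2 * s * (1 - m) * sgn y" y] m0 s by (simp add: abs_mult)
      ultimately show "\<bar>2 * s * (1 - m) * sgn y + y\<bar> \<le> 4 / s" using II s1 by simp
    qed (use s in auto)
    ultimately have num: "\<bar>sgn y * (2 * dheight x * (1 - m) - 2 * s * dpinch x) * (2 - m) + (2 * s * (1 - m) * sgn y + y) * dpinch x\<bar> \<le> 36 / s"
      using m0 by (intro order_trans[OF abs_triangle_ineq]) (simp add: abs_mult)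
    have d1: "1 \<le> (2 - m)\<^sup>2" using m0 by (simp add: one_le_power)
    have "\<bar>stretch_dx z\<bar> \<le> (36 / s) / 1"
      unfolding x1 abs_divide using num d1 s by (intro frac_le) auto
    then have "(\<bar>stretch_dx z\<bar>)\<^sup>2 \<le> (36 / s)\<^sup>2" by (intro power_mono) auto
    then have x2: "(stretch_dx z)\<^sup>2 \<le> 1296 / s\<^sup>2" by (simp add: power_divide)
    have "1 \<le> (1 / s)\<^sup>2" using s1 by (simp add: one_le_power)
    then have s2: "1 \<le> 1 / s\<^sup>2" by (simp add: power_divide)
    have yle: "stretch_dy z \<le> 1" unfolding y1 using m0 by simp
    have y2: "(stretch_dy z)\<^sup>2 \<le> 1" using yle stretch_dy_pos[of z] by (simp add: power_le_one)
    have "distortion_bound z = 3 * (1 + (stretch_dx z)\<^sup>2 + (stretch_dy z)\<^sup>2) * (2 - m)" unfolding distortion_bound_def by (simp add: y1)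
    also have "\<dots> \<le> 3 * (1 / s\<^sup>2 + 1296 / s\<^sup>2 + 1 / s\<^sup>2) * 2"
      using x2 y2 s2 m0 by (intro mult_mono) auto
    also have "\<dots> = 7788 / s\<^sup>2" by simp
    finally have "distortion_bound z \<le> 7788 / s\<^sup>2" .
    moreover have ind: "indicator {- (2 * s)..2 * s} y = (1::real)" using II by (simp add: abs_less_iff)
    ultimately show ?thesis using nn(1) unfolding ind by linarith
  next
    case III
    then have "stretch_dy z = 1" "stretch_dx z = 0" by (simp_all add: stretch_dy_def stretch_dx_def x_def y_def s_def m_def)
    then show ?thesis using nn by (simp add: distortion_bound_def)
  qed
  then show ?thesis by (simp only: x_def y_def s_def m_def)
qed

lemma measurable_height[measurable]: "height \<in> borel_measurable borel"
  by (rule borel_measurable_continuous_onI[OF continuous_on_height])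

lemma measurable_pinch[measurable]: "pinch \<in> borel_measurable borel"
  by (rule borel_measurable_continuous_onI[OF continuous_on_pinch])

lemma measurable_dheight[measurable]: "dheight \<in> borel_measurable borel"
  unfolding dheight_def[abs_def] by measurable

lemma measurable_dpinch[measurable]: "dpinch \<in> borel_measurable borel"
  unfolding dpinch_def[abs_def] by measurable

lemma measurable_stretch_dx[measurable]: "stretch_dx \<in> borel_measurable borel"
  unfolding stretch_dx_def[abs_def] by measurable

lemma measurable_stretch_dy[measurable]: "stretch_dy \<in> borel_measurable borel"
  unfolding stretch_dy_def[abs_def] by measurable

lemma measurable_distortion_bound[measurable]: "distortion_bound \<in> borel_measurable borel"
  unfolding distortion_bound_def[abs_def] by measurable

lemma nn_integral_inverse_height: "(\<integral>\<^sup>+x. ennreal (1 / height x) \<partial>lborel) < \<infinity>"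
proof -
  have z: "height x = 0" if "\<bar>x\<bar> \<ge> 1" for x
    using height_pos_iff[of x] height_nonneg[of x] that by linarith
  have "((\<lambda>x. 1 / height x) has_integral (arcsin 1 - arcsin (- 1))) {- 1..1}"
  proof (rule fundamental_theorem_of_calculus_interior)
    show "continuous_on {- 1..1} arcsin" by (rule continuous_on_arcsin')
    fix x :: real assume x: "x \<in> {- 1<..<1}"
    then have "x\<^sup>2 < 1" by (simp add: abs_square_less_1 abs_less_iff)
    then show "(arcsin has_vector_derivative 1 / height x) (at x)"
      using DERIV_arcsin[of x] x
      by (simp add: has_real_derivative_iff_has_vector_derivative[symmetric] height_def divide_inverse)
  qed simp
  then have "((\<lambda>x. 1 / height x) has_integral (arcsin 1 - arcsin (- 1))) UNIV"
    by (rule has_integral_on_superset) (auto simp: z)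
  then have "(\<integral>\<^sup>+x. ennreal (1 / height x) \<partial>lborel) = ennreal (arcsin 1 - arcsin (- 1))"
    by (intro nn_integral_has_integral_lborel) (auto simp: height_nonneg)
  then show ?thesis by simp
qed

lemma distortion_bound_integrable:
  "(\<integral>\<^sup>+z. ennreal (distortion_bound z) * indicator C z \<partial>lborel) < \<infinity>" if "compact C"
proof -
  have C[measurable]: "C \<in> sets borel" using that by (simp add: borel_compact)
  define I1 I2 where "I1 z = 54 / pinch (z $ 1) * indicator {- (height (z $ 1) * pinch (z $ 1))..height (z $ 1) * pinch (z $ 1)} (z $ 2)"
    and "I2 z = 7788 / (height (z $ 1))\<^sup>2 * indicator {- (2 * height (z $ 1))..2 * height (z $ 1)} (z $ 2)" for z :: "real^2"
  have I: "I1 z = (if \<bar>z $ 2\<bar> \<le> height (z $ 1) * pinch (z $ 1) then 54 / pinch (z $ 1) else 0)"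
    "I2 z = (if \<bar>z $ 2\<bar> \<le> 2 * height (z $ 1) then 7788 / (height (z $ 1))\<^sup>2 else 0)" for z
    by (auto simp: I1_def I2_def indicator_def abs_le_iff)
  have [measurable]: "I1 \<in> borel_measurable borel" "I2 \<in> borel_measurable borel"
    unfolding I[abs_def] by measurable
  have nn: "0 \<le> I1 z" "0 \<le> I2 z" for z by (auto simp: I pinch_nonneg)
  have "(\<integral>\<^sup>+z. ennreal (distortion_bound z) * indicator C z \<partial>lborel) \<le>
      (\<integral>\<^sup>+z. (6 * indicator C z + ennreal (I1 z)) + ennreal (I2 z) \<partial>lborel)"
  proof (intro nn_integral_mono)
    fix z
    have "ennreal (distortion_bound z) \<le> 6 + ennreal (I1 z) + ennreal (I2 z)"
      using distortion_bound_le[of z, folded I1_def I2_def] nn[of z]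
      by (simp add: ennreal_leI flip: ennreal_plus ennreal_numeral)
    then show "ennreal (distortion_bound z) * indicator C z \<le> 6 * indicator C z + ennreal (I1 z) + ennreal (I2 z)"
      by (auto simp: indicator_def)
  qed
  also have "\<dots> = 6 * emeasure lborel C + (\<integral>\<^sup>+z. ennreal (I1 z) \<partial>lborel) + (\<integral>\<^sup>+z. ennreal (I2 z) \<partial>lborel)"
    by (simp add: nn_integral_add nn_integral_cmult)
  also have "\<dots> < \<infinity>"
  proof -
    have int: "(\<integral>\<^sup>+t. ennreal (a * indicator {- b..b} t) \<partial>lborel) = ennreal (a * (2 * b))" if "0 \<le> a" "0 \<le> b" for a b :: real
    proof -
      have "(\<integral>\<^sup>+t. ennreal (a * indicator {- b..b} t) \<partial>lborel) = (\<integral>\<^sup>+t. ennreal a * indicator {- b..b} t \<partial>lborel)"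
        by (intro nn_integral_cong) (auto simp: indicator_def)
      also have "\<dots> = ennreal a * ennreal (2 * b)" using that by (simp add: nn_integral_cmult_indicator)
      finally show ?thesis using that by (simp add: ennreal_mult)
    qed
    have s: "height c \<le> 1 / height c" for c
      using height_nonneg[of c] height_le_1[of c] by (cases "height c = 0") (simp_all add: field_simps mult_le_one)
    have "(\<integral>\<^sup>+z. ennreal (I1 z) \<partial>lborel) = (\<integral>\<^sup>+c. ennreal (54 / pinch c * (2 * (height c * pinch c))) \<partial>lborel)"
    proof (subst nn_integral_line[of _ 2])
      have "I1 (line 2 c t) = 54 / pinch c * indicator {- (height c * pinch c)..height c * pinch c} t" for c t
        by (simp add: I1_def line_nth)
      then show "(\<integral>\<^sup>+c. \<integral>\<^sup>+t. ennreal (I1 (line 2 c t)) \<partial>lborel \<partial>lborel) =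
          (\<integral>\<^sup>+c. ennreal (54 / pinch c * (2 * (height c * pinch c))) \<partial>lborel)"
        by (simp only:) (subst int; simp add: height_nonneg pinch_nonneg)
    qed measurable
    also have "\<dots> \<le> (\<integral>\<^sup>+c. ennreal 108 * ennreal (1 / height c) \<partial>lborel)"
    proof (intro nn_integral_mono)
      fix c
      have "54 / pinch c * (2 * (height c * pinch c)) \<le> 108 * (1 / height c)"
        using s[of c] height_nonneg[of c] by (cases "pinch c = 0") auto
      then have "ennreal (54 / pinch c * (2 * (height c * pinch c))) \<le> ennreal (108 * (1 / height c))"
        by (rule ennreal_leI)
      also have "\<dots> = ennreal 108 * ennreal (1 / height c)"
        using height_nonneg[of c] by (intro ennreal_mult) simp_all
      finally show "ennreal (54 / pinch c * (2 * (height c * pinch c))) \<le> ennreal 108 * ennreal (1 / height c)" .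
    qed
    also have "\<dots> < \<infinity>"
      using nn_integral_inverse_height by (simp add: nn_integral_cmult ennreal_mult_less_top)
    finally have 1: "(\<integral>\<^sup>+z. ennreal (I1 z) \<partial>lborel) < \<infinity>" .
    have "(\<integral>\<^sup>+z. ennreal (I2 z) \<partial>lborel) = (\<integral>\<^sup>+c. ennreal (7788 / (height c)\<^sup>2 * (2 * (2 * height c))) \<partial>lborel)"
    proof (subst nn_integral_line[of _ 2])
      have "I2 (line 2 c t) = 7788 / (height c)\<^sup>2 * indicator {- (2 * height c)..2 * height c} t" for c t
        by (simp add: I2_def line_nth)
      then show "(\<integral>\<^sup>+c. \<integral>\<^sup>+t. ennreal (I2 (line 2 c t)) \<partial>lborel \<partial>lborel) =
          (\<integral>\<^sup>+c. ennreal (7788 / (height c)\<^sup>2 * (2 * (2 * height c))) \<partial>lborel)"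
        by (simp only:) (subst int; simp add: height_nonneg)
    qed measurable
    also have "\<dots> = (\<integral>\<^sup>+c. ennreal 31152 * ennreal (1 / height c) \<partial>lborel)"
    proof (intro nn_integral_cong)
      fix c
      have "7788 / (height c)\<^sup>2 * (2 * (2 * height c)) = 31152 * (1 / height c)"
        by (simp add: power2_eq_square)
      then have "ennreal (7788 / (height c)\<^sup>2 * (2 * (2 * height c))) = ennreal (31152 * (1 / height c))"
        by (simp only:)
      also have "\<dots> = ennreal 31152 * ennreal (1 / height c)"
        using height_nonneg[of c] by (intro ennreal_mult) simp_all
      finally show "ennreal (7788 / (height c)\<^sup>2 * (2 * (2 * height c))) = ennreal 31152 * ennreal (1 / height c)" .
    qed
    also have "\<dots> < \<infinity>"
      using nn_integral_inverse_height by (simp add: nn_integral_cmult ennreal_mult_less_top)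
    finally have 2: "(\<integral>\<^sup>+z. ennreal (I2 z) \<partial>lborel) < \<infinity>" .
    have "emeasure lborel C < \<infinity>" using that by (rule emeasure_compact_finite)
    then show ?thesis using 1 2 by (simp add: ennreal_mult_less_top)
  qed
  finally show ?thesis .
qed

text \<open>The differential of \<^const>\<open>stretch\<close>, with the gradients of the components as rows.\<close>

definition stretch_matrix :: "real^2 \<Rightarrow> real^2^2" where
  "stretch_matrix z = (\<chi> i. if i = 1 then axis 1 1 else line 2 (stretch_dx z) (stretch_dy z))"

lemma stretch_matrix_nth:
  "stretch_matrix z $ 1 = axis 1 1"
  "stretch_matrix z $ 2 = line 2 (stretch_dx z) (stretch_dy z)"
  by (simp_all add: stretch_matrix_def)

lemma twice_distortion_bound_integrable:
  "compact C \<Longrightarrow> (\<integral>\<^sup>+z. ennreal (2 * distortion_bound z) * indicator C z \<partial>lborel) < \<infinity>"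
proof -
  assume C: "compact C"
  then have [measurable]: "C \<in> sets borel" by (rule borel_compact)
  have "(\<integral>\<^sup>+z. ennreal (2 * distortion_bound z) * indicator C z \<partial>lborel) =
      (\<integral>\<^sup>+z. ennreal 2 * (ennreal (distortion_bound z) * indicator C z) \<partial>lborel)"
    using distortion_bound_estimates(1) by (intro nn_integral_cong) (simp add: ennreal_mult' mult.assoc)
  also have "\<dots> < \<infinity>" using distortion_bound_integrable[OF C] by (simp add: nn_integral_cmult ennreal_mult_less_top)
  finally show ?thesis .
qed

lemma has_weak_differential_stretch: "has_weak_differential UNIV stretch stretch_matrix"
  unfolding has_weak_differential_def
proof
  fix k :: 2
  consider "k = 1" | "k = 2" using exhaust_2 by blast
  then show "has_weak_gradient UNIV (\<lambda>x. stretch x $ k) (\<lambda>x. stretch_matrix x $ k)"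
  proof cases
    case 1
    have "has_weak_gradient UNIV (\<lambda>x. x $ 1) (\<lambda>x. axis 1 1)"
    proof (rule has_weak_gradientI)
      show "in_Lp_loc 1 UNIV (\<lambda>x::real^2. x $ 1)" "in_Lp_loc 1 UNIV (\<lambda>x::real^2. axis 1 1 :: real^2)"
        by (intro in_Lp_loc_continuous continuous_intros)+
      fix i :: 2
      have "((\<lambda>t. line i c t $ 1) has_real_derivative (axis 1 1 :: real^2) $ i) (at t)" for c t
        using exhaust_2[of i] by (auto simp: line_nth axis_def)
      then have "\<exists>S. finite S \<and> continuous_on {t. line i c t \<in> UNIV} (\<lambda>t. line i c t $ 1) \<and>
            (\<forall>t. line i c t \<in> UNIV \<longrightarrow> t \<notin> S \<longrightarrow>
              ((\<lambda>t. line i c t $ 1) has_real_derivative (axis 1 1 :: real^2) $ i) (at t))" for c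
        by (intro exI[of _ "{}"]) (auto intro!: continuous_on_component continuous_on_line)
      then show "AE c in lborel. \<exists>S. finite S \<and> continuous_on {t. line i c t \<in> UNIV} (\<lambda>t. line i c t $ 1) \<and>
            (\<forall>t. line i c t \<in> UNIV \<longrightarrow> t \<notin> S \<longrightarrow>
              ((\<lambda>t. line i c t $ 1) has_real_derivative (axis 1 1 :: real^2) $ i) (at t))" by simp
    qed auto
    then show ?thesis using 1 by (simp add: stretch_matrix_nth stretch_def line_nth)
  next
    case 2
    have "has_weak_gradient UNIV (\<lambda>x. stretch x $ 2) (\<lambda>x. line 2 (stretch_dx x) (stretch_dy x))"
    proof (rule has_weak_gradientI)
      show [measurable]: "(\<lambda>x. stretch x $ 2) \<in> borel_measurable borel"
        by (intro borel_measurable_continuous_onI continuous_on_component continuous_on_stretch)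
      show "(\<lambda>x. line 2 (stretch_dx x) (stretch_dy x)) \<in> borel_measurable borel" by measurable
      show "in_Lp_loc 1 UNIV (\<lambda>x. stretch x $ 2)"
        by (intro in_Lp_loc_continuous continuous_on_component continuous_on_stretch)
      show "in_Lp_loc 1 UNIV (\<lambda>x. line 2 (stretch_dx x) (stretch_dy x))"
      proof (rule in_Lp_loc_bound[OF _ _ twice_distortion_bound_integrable])
        fix z show "norm (line 2 (stretch_dx z) (stretch_dy z)) \<le> 2 * distortion_bound z"
          using norm_line_le[of "stretch_dx z" "stretch_dy z"] distortion_bound_estimates(2,3)[of z] stretch_dy_pos[of z] by linarith
      qed measurable
      fix i :: 2
      have cont: "continuous_on A (\<lambda>t. stretch (line i c t) $ 2)" for A c
        by (intro continuous_on_component continuous_on_compose2[OF continuous_on_stretch] continuous_on_line) auto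
      have "AE c in lborel. \<exists>S. finite S \<and> (\<forall>t. t \<notin> S \<longrightarrow>
              ((\<lambda>t. stretch (line i c t) $ 2) has_real_derivative line 2 (stretch_dx (line i c t)) (stretch_dy (line i c t)) $ i) (at t))"
      proof (cases "i = 1")
        case True
        have "AE c in lborel. c \<noteq> (0::real)" by (rule AE_lborel_singleton)
        then show ?thesis
          by eventually_elim (use stretch_line_x True in \<open>simp add: stretch_def line_nth\<close>)
      next
        case False
        then have "i = 2" using exhaust_2 by blast
        then show ?thesis using stretch_line_y by (simp add: stretch_def line_nth)
      qed
      then show "AE c in lborel. \<exists>S. finite S \<and> continuous_on {t. line i c t \<in> UNIV} (\<lambda>t. stretch (line i c t) $ 2) \<and>
            (\<forall>t. line i c t \<in> UNIV \<longrightarrow> t \<notin> S \<longrightarrow>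
              ((\<lambda>t. stretch (line i c t) $ 2) has_real_derivative line 2 (stretch_dx (line i c t)) (stretch_dy (line i c t)) $ i) (at t))"
        by eventually_elim (use cont in auto)
    qed simp
    then show ?thesis using 2 by (simp add: stretch_matrix_nth)
  qed
qed

lemma det_stretch_matrix: "det (stretch_matrix z) = stretch_dy z"
  by (simp add: det_2 stretch_matrix_nth axis_def line_nth)

lemma onorm_stretch_matrix: "onorm ((*v) (stretch_matrix z)) \<le> 1 + \<bar>stretch_dx z\<bar> + stretch_dy z"
  using onorm_le_matrix_component_sum[of "stretch_matrix z"] stretch_dy_pos[of z]
  by (simp add: sum_2 stretch_matrix_nth axis_def line_nth)

lemma onorm_stretch_matrix_square: "(onorm ((*v) (stretch_matrix z)))\<^sup>2 \<le> distortion_bound z * stretch_dy z"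
proof -
  have "0 \<le> onorm ((*v) (stretch_matrix z))" by (rule onorm_pos_le) (rule matrix_vector_mul_bounded_linear)
  then have "(onorm ((*v) (stretch_matrix z)))\<^sup>2 \<le> (1 + \<bar>stretch_dx z\<bar> + stretch_dy z)\<^sup>2"
    by (intro power_mono onorm_stretch_matrix)
  also have "\<dots> \<le> distortion_bound z * stretch_dy z" by (rule distortion_bound_estimates)
  finally show ?thesis .
qed

lemma continuous_onorm_matrix: "continuous_on UNIV (\<lambda>A :: real^'n^'m. onorm ((*v) A))"
proof -
  have le: "onorm ((*v) A) - onorm ((*v) B) \<le> (\<Sum>i\<in>UNIV. \<Sum>j\<in>UNIV. \<bar>A $ i $ j - B $ i $ j\<bar>)" for A B :: "real^'n^'m"
  proof -
    have "onorm (\<lambda>v. (A - B) *v v + B *v v) \<le> onorm ((*v) (A - B)) + onorm ((*v) B)"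
      by (rule onorm_triangle) (rule matrix_vector_mul_bounded_linear)+
    moreover have "(\<lambda>v. (A - B) *v v + B *v v) = (*v) A"
      by (simp add: fun_eq_iff matrix_vector_mult_diff_rdistrib)
    ultimately show ?thesis
      using onorm_le_matrix_component_sum[of "A - B"] by simp
  qed
  have "isCont (\<lambda>A. onorm ((*v) A)) B" for B :: "real^'n^'m"
    unfolding isCont_def
  proof (rule Lim_transform2[OF tendsto_const])
    have "((\<lambda>A. \<Sum>i\<in>UNIV. \<Sum>j\<in>UNIV. \<bar>A $ i $ j - B $ i $ j\<bar>) \<longlongrightarrow> (\<Sum>i\<in>UNIV. \<Sum>j\<in>UNIV. \<bar>B $ i $ j - B $ i $ j\<bar>)) (at B)"
      by (intro tendsto_intros)
    then have *: "((\<lambda>A. \<Sum>i\<in>UNIV. \<Sum>j\<in>UNIV. \<bar>A $ i $ j - B $ i $ j\<bar>) \<longlongrightarrow> 0) (at B)" by simp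
    show "((\<lambda>A. onorm ((*v) B) - onorm ((*v) A)) \<longlongrightarrow> 0) (at B)"
    proof (rule Lim_null_comparison[OF _ *], rule always_eventually, rule allI)
      fix A
      show "norm (onorm ((*v) B) - onorm ((*v) A)) \<le> (\<Sum>i\<in>UNIV. \<Sum>j\<in>UNIV. \<bar>A $ i $ j - B $ i $ j\<bar>)"
        using le[of A B] le[of B A] by (simp add: abs_le_iff abs_minus_commute)
    qed
  qed
  then show ?thesis by (simp add: continuous_at_imp_continuous_on)
qed

lemma measurable_stretch_matrix[measurable]: "stretch_matrix \<in> borel_measurable borel"
proof -
  have "(\<lambda>z. stretch_matrix z \<bullet> b) \<in> borel_measurable borel" if b: "b \<in> Basis" for b
  proof -
    obtain i c where "b = axis i c" using b by (auto simp: Basis_vec_def)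
    moreover have "(\<lambda>z. stretch_matrix z $ i \<bullet> c) \<in> borel_measurable borel"
      using exhaust_2[of i] by (auto simp: stretch_matrix_nth)
    ultimately show ?thesis by (simp add: inner_axis)
  qed
  then show ?thesis using borel_measurable_euclidean_space by blast
qed

lemma AE_Dnorm_jacobian:
  "AE z in lebesgue_on UNIV. Dnorm UNIV stretch z = onorm ((*v) (stretch_matrix z)) \<and> jacobian UNIV stretch z = stretch_dy z"
  using weak_differential_AE_eq[OF open_UNIV has_weak_differential_stretch]
  by eventually_elim (simp add: Dnorm_def jacobian_def det_stretch_matrix)

lemma finite_distortion_stretch: "finite_distortion_homeo UNIV stretch"
  unfolding finite_distortion_homeo_def
proof (intro conjI)
  show "domain UNIV" by (simp add: domain_def connected_UNIV)
  have "range stretch = UNIV" using homeomorphism_stretch by (simp add: homeomorphism_def)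
  then show "\<exists>g. homeomorphism UNIV (range stretch) stretch g" using homeomorphism_stretch by auto
  show "in_W11_loc UNIV stretch" using has_weak_differential_stretch by (auto simp: in_W11_loc_def)
  show "\<exists>K :: real^2 \<Rightarrow> ereal. K \<in> borel_measurable (lebesgue_on UNIV) \<and> (\<forall>z\<in>UNIV. 1 \<le> K z) \<and>
        (AE z in lebesgue_on UNIV. K z < \<infinity>) \<and>
        (AE z in lebesgue_on UNIV. ereal ((Dnorm UNIV stretch z)\<^sup>2) \<le> K z * ereal (jacobian UNIV stretch z))"
  proof (intro exI[of _ "\<lambda>z. ereal (distortion_bound z)"] conjI)
    show "(\<lambda>z. ereal (distortion_bound z)) \<in> borel_measurable (lebesgue_on UNIV)"
      by (intro measurable_restrict_space1 measurable_completion) measurable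
    show "\<forall>z\<in>UNIV. 1 \<le> ereal (distortion_bound z)"
    proof
      fix z show "1 \<le> ereal (distortion_bound z)" using distortion_bound_estimates(1)[of z] by simp
    qed
    show "AE z in lebesgue_on UNIV. ereal ((Dnorm UNIV stretch z)\<^sup>2) \<le> ereal (distortion_bound z) * ereal (jacobian UNIV stretch z)"
      using AE_Dnorm_jacobian by eventually_elim (simp add: onorm_stretch_matrix_square)
  qed simp
qed

lemma optimal_distortion_stretch: "in_Lp_loc 1 UNIV (optimal_distortion UNIV stretch)"
  unfolding in_Lp_loc_def
proof (intro allI impI)
  fix C :: "(real^2) set" assume C: "compact C \<and> C \<subseteq> UNIV"
  then have CL: "C \<in> sets lebesgue" by (simp add: lmeasurable_compact fmeasurableD)
  let ?k = "\<lambda>z. (onorm ((*v) (stretch_matrix z)))\<^sup>2 / stretch_dy z"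
  have [measurable]: "(\<lambda>z. onorm ((*v) (stretch_matrix z))) \<in> borel_measurable borel"
    by (rule measurable_compose[OF measurable_stretch_matrix borel_measurable_continuous_onI[OF continuous_onorm_matrix]])
  have "in_Lp_loc 1 UNIV ?k"
  proof (rule in_Lp_loc_bound[OF _ _ distortion_bound_integrable])
    fix z show "norm (?k z) \<le> distortion_bound z"
      using onorm_stretch_matrix_square[of z] stretch_dy_pos[of z] by (simp add: pos_divide_le_eq)
  qed measurable
  then have "in_Lp 1 C ?k" using C by (simp add: in_Lp_loc_def)
  moreover have "AE z in lebesgue_on UNIV. ?k z = optimal_distortion UNIV stretch z"
    using AE_Dnorm_jacobian by eventually_elim (simp add: optimal_distortion_def stretch_dy_pos)
  then have "AE z in lebesgue_on C. ?k z = optimal_distortion UNIV stretch z"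
    unfolding lebesgue_on_UNIV_eq using CL by (subst AE_restrict_space_iff) (auto elim: eventually_mono)
  ultimately show "in_Lp 1 C (optimal_distortion UNIV stretch)"
    using in_Lp_AE[OF CL] by blast
qed

lemma quasidisk_cusp_domain: "Lp_quasidisk 1 cusp_domain"
  unfolding Lp_quasidisk_def
  using cusp_domain_props finite_distortion_stretch optimal_distortion_stretch stretch_image homeomorphism_stretch
  by (auto simp: homeomorphism_def intro!: exI[of _ stretch])

section \<open>A Sobolev function without weakly differentiable extension\<close>

lemma powr_times_exp_le:
  fixes t a :: real assumes "t > 0" "a > 0"
  shows "t powr a * exp (- t) \<le> a powr a"
proof -
  \<comment> \<open>Raise \<open>t / a \<le> exp (t / a)\<close> to the power \<open>a\<close>.\<close>
  have "t / a \<le> exp (t / a)" using exp_ge_add_one_self[of "t / a"] by linarith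
  then have "t \<le> a * exp (t / a)" using assms by (simp add: field_simps)
  then have "t powr a \<le> (a * exp (t / a)) powr a" using assms by (intro powr_mono2) auto
  also have "\<dots> = a powr a * exp t" using assms by (simp add: powr_mult exp_powr_real)
  finally show ?thesis by (simp add: exp_minus field_simps)
qed

text \<open>The function \<open>u\<close> that blows up at the tips of the cusps, and its gradient.\<close>

definition cusp_function :: "real^2 \<Rightarrow> real" where
  "cusp_function z = 1 / (1 - (z $ 1)\<^sup>2)\<^sup>2"

definition cusp_function_grad :: "real^2 \<Rightarrow> real^2" where
  "cusp_function_grad z = line 2 (4 * z $ 1 / (1 - (z $ 1)\<^sup>2) ^ 3) 0"

lemma measurable_cusp_function[measurable]: "cusp_function \<in> borel_measurable borel"
  unfolding cusp_function_def[abs_def] by measurable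

lemma measurable_cusp_function_grad[measurable]: "cusp_function_grad \<in> borel_measurable borel"
  unfolding cusp_function_grad_def[abs_def] by measurable

lemma cusp_domain_D: "z \<in> cusp_domain \<Longrightarrow> \<bar>z $ 1\<bar> < 1"
  using height_pos_of_less(1) by (simp add: cusp_domain_def)

lemma sets_cusp_domain[measurable]: "cusp_domain \<in> sets borel"
  using cusp_domain_props(1) by simp

text \<open>Power growth at the tips is compensated by the exponential decay of the width of the cusps.\<close>

lemma nn_integral_cusp_domain_finite:
  fixes f :: "real^2 \<Rightarrow> 'b::euclidean_space"
  assumes [measurable]: "f \<in> borel_measurable borel" and p: "p > 0"
    and bd: "\<And>z. z \<in> cusp_domain \<Longrightarrow> norm (f z) \<le> 4 / (1 - (z $ 1)\<^sup>2) ^ 3"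
  shows "(\<integral>\<^sup>+z. ennreal (norm (f z) powr p) * indicator cusp_domain z \<partial>lborel) < \<infinity>"
proof -
  define w where "w c = (4 / (1 - c\<^sup>2) ^ 3) powr p" for c :: real
  define M where "M = 2 * (4 powr p * (3 * p) powr (3 * p))"
  have M: "w c * (2 * (height c * pinch c)) \<le> M" if c: "\<bar>c\<bar> < 1" for c
  proof -
    have q: "0 < 1 - c\<^sup>2" using c by (simp add: abs_square_less_1)
    define t where "t = 1 / (1 - c\<^sup>2)"
    have t: "t > 0" using q by (simp add: t_def)
    have "w c = (4 * t ^ 3) powr p" by (simp add: w_def t_def power_divide)
    also have "\<dots> = 4 powr p * (t powr 3) powr p"
      using t by (simp add: powr_mult)
    also have "\<dots> = 4 powr p * t powr (3 * p)"
      by (simp add: powr_powr)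
    finally have w: "w c = 4 powr p * t powr (3 * p)" .
    have "w c * (2 * (height c * pinch c)) \<le> w c * (2 * (1 * pinch c))"
      using height_le_1[of c] pinch_nonneg[of c] by (intro mult_left_mono mult_right_mono) (auto simp: w_def)
    also have "\<dots> = 2 * (4 powr p * (t powr (3 * p) * exp (- t)))"
      using q by (simp add: w pinch_def flat_def t_def)
    also have "\<dots> \<le> M"
      unfolding M_def using powr_times_exp_le[OF t, of "3 * p"] p by (intro mult_left_mono) auto
    finally show ?thesis .
  qed
  have M0: "0 \<le> M" by (simp add: M_def)
  have ind: "(indicator cusp_domain (line 2 c t) :: ennreal) = indicator {- (height c * pinch c)<..<height c * pinch c} t" for c t
    by (auto simp: cusp_domain_def line_nth indicator_def abs_less_iff)
  have [measurable]: "w \<in> borel_measurable borel" unfolding w_def[abs_def] by measurable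
  have "(\<integral>\<^sup>+z. ennreal (norm (f z) powr p) * indicator cusp_domain z \<partial>lborel) \<le>
      (\<integral>\<^sup>+z. ennreal (w (z $ 1)) * indicator cusp_domain z \<partial>lborel)"
    using bd p by (intro nn_integral_mono) (auto simp: indicator_def w_def intro!: ennreal_leI powr_mono2)
  also have "\<dots> = (\<integral>\<^sup>+c. \<integral>\<^sup>+t. ennreal (w c) * indicator {- (height c * pinch c)<..<height c * pinch c} t \<partial>lborel \<partial>lborel)"
  proof (subst nn_integral_line[of _ 2])
    have [simp]: "line 2 c t $ 1 = c" for c t by (simp add: line_nth)
    show "(\<integral>\<^sup>+c. \<integral>\<^sup>+t. ennreal (w (line 2 c t $ 1)) * indicator cusp_domain (line 2 c t) \<partial>lborel \<partial>lborel) =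
      (\<integral>\<^sup>+c. \<integral>\<^sup>+t. ennreal (w c) * indicator {- (height c * pinch c)<..<height c * pinch c} t \<partial>lborel \<partial>lborel)"
      by (simp add: ind)
  qed measurable
  also have "\<dots> = (\<integral>\<^sup>+c. ennreal (w c * (2 * (height c * pinch c))) \<partial>lborel)"
  proof (intro nn_integral_cong)
    fix c
    have "(\<integral>\<^sup>+t. ennreal (w c) * indicator {- (height c * pinch c)<..<height c * pinch c} t \<partial>lborel) =
        ennreal (w c) * ennreal (2 * (height c * pinch c))"
      by (subst nn_integral_cmult_indicator) (simp_all add: height_nonneg pinch_nonneg mult.commute)
    then show "(\<integral>\<^sup>+t. ennreal (w c) * indicator {- (height c * pinch c)<..<height c * pinch c} t \<partial>lborel) =
        ennreal (w c * (2 * (height c * pinch c)))"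
      by (simp add: ennreal_mult' w_def)
  qed
  also have "\<dots> \<le> (\<integral>\<^sup>+c. ennreal M * indicator {-1..1::real} c \<partial>lborel)"
  proof (intro nn_integral_mono)
    fix c
    show "ennreal (w c * (2 * (height c * pinch c))) \<le> ennreal M * indicator {-1..1} c"
    proof (cases "\<bar>c\<bar> < 1")
      case True
      then show ?thesis using M by (auto simp: indicator_def intro: ennreal_leI)
    next
      case False
      then have "pinch c = 0" using pinch_pos_iff[of c] pinch_nonneg[of c] by linarith
      then show ?thesis by simp
    qed
  qed
  also have "\<dots> < \<infinity>" by (simp add: nn_integral_cmult_indicator ennreal_mult_less_top)
  finally show ?thesis .
qed

lemma cusp_function_bound: "z \<in> cusp_domain \<Longrightarrow> norm (cusp_function z) \<le> 4 / (1 - (z $ 1)\<^sup>2) ^ 3"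
  and cusp_function_grad_bound: "z \<in> cusp_domain \<Longrightarrow> norm (cusp_function_grad z) \<le> 4 / (1 - (z $ 1)\<^sup>2) ^ 3"
proof -
  assume "z \<in> cusp_domain"
  then have z: "\<bar>z $ 1\<bar> < 1" by (rule cusp_domain_D)
  define q where "q = 1 - (z $ 1)\<^sup>2"
  have q: "0 < q" "q \<le> 1" using z by (simp_all add: q_def abs_square_less_1)
  have "cusp_function z = 1 / q\<^sup>2" by (simp only: cusp_function_def q_def)
  then have "norm (cusp_function z) = q / q ^ 3" using q by (simp add: power2_eq_square power3_eq_cube)
  also have "\<dots> \<le> 4 / q ^ 3" using q by (intro divide_right_mono) auto
  finally show "norm (cusp_function z) \<le> 4 / (1 - (z $ 1)\<^sup>2) ^ 3" by (simp add: q_def)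
  have "norm (cusp_function_grad z) \<le> 4 * \<bar>z $ 1\<bar> / q ^ 3"
    using norm_line_le[of "4 * z $ 1 / q ^ 3" 0] q by (simp add: cusp_function_grad_def q_def[symmetric] abs_mult)
  also have "\<dots> \<le> 4 / q ^ 3" using z q by (intro divide_right_mono) auto
  finally show "norm (cusp_function_grad z) \<le> 4 / (1 - (z $ 1)\<^sup>2) ^ 3" by (simp add: q_def)
qed

lemma has_weak_gradient_cusp_function: "has_weak_gradient cusp_domain cusp_function cusp_function_grad"
proof (rule has_weak_gradientI[OF cusp_domain_props(1)])
  have loc: "in_Lp_loc 1 cusp_domain f" if [measurable]: "f \<in> borel_measurable borel"
    and bd: "\<And>z. z \<in> cusp_domain \<Longrightarrow> norm (f z) \<le> 4 / (1 - (z $ 1)\<^sup>2) ^ 3" for f :: "real^2 \<Rightarrow> 'b::euclidean_space"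
  proof (rule in_Lp_locI)
    fix C assume C: "C \<subseteq> cusp_domain"
    have "(\<integral>\<^sup>+z. ennreal (norm (f z)) * indicator C z \<partial>lborel) \<le> (\<integral>\<^sup>+z. ennreal (norm (f z) powr 1) * indicator cusp_domain z \<partial>lborel)"
      using C by (intro nn_integral_mono) (auto simp: indicator_def)
    also have "\<dots> < \<infinity>" by (rule nn_integral_cusp_domain_finite) (auto intro: bd)
    finally show "(\<integral>\<^sup>+z. ennreal (norm (f z)) * indicator C z \<partial>lborel) < \<infinity>" .
  qed fact
  show "in_Lp_loc 1 cusp_domain cusp_function" by (rule loc[OF measurable_cusp_function cusp_function_bound])
  show "in_Lp_loc 1 cusp_domain cusp_function_grad" by (rule loc[OF measurable_cusp_function_grad cusp_function_grad_bound])
  fix i :: 2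
  have D: "((\<lambda>t. cusp_function (line i c t)) has_real_derivative cusp_function_grad (line i c t) $ i) (at t)" if "line i c t \<in> cusp_domain" for c t
  proof (cases "i = 1")
    case True
    have "\<bar>t\<bar> < 1" using cusp_domain_D[OF that] True by (simp add: line_nth)
    then have q: "1 - t\<^sup>2 \<noteq> 0" using abs_square_less_1[of t] by simp
    have "((\<lambda>t. 1 / (1 - t\<^sup>2)\<^sup>2) has_real_derivative 4 * t / (1 - t\<^sup>2) ^ 3) (at t)"
    proof (rule DERIV_cong)
      show "((\<lambda>t. 1 / (1 - t\<^sup>2)\<^sup>2) has_real_derivative
          (0 * (1 - t\<^sup>2)\<^sup>2 - 1 * (2 * (1 - t\<^sup>2) * (- (2 * t)))) / ((1 - t\<^sup>2)\<^sup>2 * (1 - t\<^sup>2)\<^sup>2)) (at t)"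
        using q by (intro DERIV_divide) (auto intro!: derivative_eq_intros)
      have "(0 * r\<^sup>2 - 1 * (2 * r * (- (2 * t)))) / (r\<^sup>2 * r\<^sup>2) = 4 * t / r ^ 3" if "r \<noteq> 0" for r :: real
        using that by (simp add: field_simps power2_eq_square power3_eq_cube)
      from this[OF q] show "(0 * (1 - t\<^sup>2)\<^sup>2 - 1 * (2 * (1 - t\<^sup>2) * (- (2 * t)))) / ((1 - t\<^sup>2)\<^sup>2 * (1 - t\<^sup>2)\<^sup>2)
          = 4 * t / (1 - t\<^sup>2) ^ 3" .
    qed
    then show ?thesis using True by (simp add: cusp_function_def cusp_function_grad_def line_nth)
  next
    case False
    then have "i = 2" using exhaust_2 by blast
    then show ?thesis by (simp add: cusp_function_def cusp_function_grad_def line_nth)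
  qed
  have "continuous_on {t. line i c t \<in> cusp_domain} (\<lambda>t. cusp_function (line i c t))" for c
    by (intro continuous_at_imp_continuous_on ballI) (use D DERIV_isCont in blast)
  then show "AE c in lborel. \<exists>S. finite S \<and> continuous_on {t. line i c t \<in> cusp_domain} (\<lambda>t. cusp_function (line i c t)) \<and>
       (\<forall>t. line i c t \<in> cusp_domain \<longrightarrow> t \<notin> S \<longrightarrow> ((\<lambda>t. cusp_function (line i c t)) has_real_derivative cusp_function_grad (line i c t) $ i) (at t))"
    using D by (intro always_eventually allI exI[of _ "{}"]) auto
qed auto

lemma cusp_function_in_W1p: "p \<ge> 1 \<Longrightarrow> in_W1p p cusp_domain cusp_function"
proof -
  assume p: "p \<ge> 1"
  have L: "cusp_domain \<in> sets lebesgue" using cusp_domain_props(1) by simp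
  have "in_Lp p cusp_domain cusp_function"
    by (rule in_LpI[OF sets_cusp_domain measurable_cusp_function nn_integral_cusp_domain_finite[OF measurable_cusp_function _ cusp_function_bound]])
      (use p in simp)
  moreover have "in_Lp p cusp_domain cusp_function_grad"
    by (rule in_LpI[OF sets_cusp_domain measurable_cusp_function_grad
          nn_integral_cusp_domain_finite[OF measurable_cusp_function_grad _ cusp_function_grad_bound]])
      (use p in simp)
  then have "in_Lp p cusp_domain (weak_gradient cusp_domain cusp_function)"
    by (rule in_Lp_AE[OF L]) (use weak_gradient_AE_eq[OF cusp_domain_props(1) has_weak_gradient_cusp_function] in eventually_elim, simp)
  ultimately show ?thesis
    using has_weak_gradient_cusp_function by (auto simp: in_W1p_def weakly_differentiable_def)
qed

text \<open>Let \<open>v\<close> extend \<open>u\<close>. The test function is \<open>\<eta>(x) S(y / \<epsilon>) T(y)\<close>, where \<open>\<eta>\<close> is a bump of width \<open>1 / N\<close> at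
  distance about \<open>1 / N\<close> from the tip \<open>(1, 0)\<close>, \<open>S\<close> is the smooth step and \<open>T\<close> a fixed cutoff. Its
  \<open>y\<close>-derivative consists of a term \<open>\<psi>1\<close> of size \<open>1 / \<epsilon>\<close>, supported in the domain, where \<open>v = u\<close>, and a term \<open>\<psi>2\<close>
  bounded independently of \<open>N\<close> and \<open>\<epsilon>\<close>. Testing bounds the integral of \<open>u \<psi>1\<close> by a constant that does
  not depend on \<open>N\<close>, whereas \<open>u \<ge> N\<^sup>2 / 16\<close> near the tip makes this integral grow like \<open>N\<close>.\<close>

lemma cusp_function_no_extension:
  assumes wd: "weakly_differentiable UNIV v" and AE: "AE z in lebesgue_on cusp_domain. v z = cusp_function z"
  shows False
proof -
  obtain G where G: "has_weak_gradient UNIV v G" using wd by (auto simp: weakly_differentiable_def)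
  have locv: "in_Lp_loc 1 UNIV v" and locG: "in_Lp_loc 1 UNIV (\<lambda>z. G z $ 2)"
    using G by (auto simp: has_weak_gradient_def intro: in_Lp_loc_component)
  obtain S B where S: "smooth S" "\<And>x. (S has_real_derivative bump (-1) 1 x) (at x)"
    "\<And>x. 0 \<le> S x" "\<And>x. S x \<le> B" using smooth_step by blast
  have B0: "0 \<le> B" using S(3)[of 0] S(4)[of 0] by linarith
  define T where "T = bump (-2) 2"
  have T: "smooth T" unfolding T_def by (rule smooth_bump)
  have T01: "0 \<le> T y" "T y \<le> 1" for y by (simp_all add: T_def bump_nonneg bump_le_1)
  have Tout: "T y = 0" if "y \<notin> {-2..2}" for y unfolding T_def by (rule bump_zero) (use that in auto)
  have dTout: "deriv T y = 0" if "y \<notin> {-2..2}" for y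
    using deriv_zero_outside[OF _ that] Tout by blast
  obtain B1 where B1: "B1 \<ge> 0" "\<And>y. \<bar>deriv T y\<bar> \<le> B1"
    using compact_support_bounded[OF smooth_continuous[OF smooth_deriv[OF T]] compact_Icc dTout]
    by blast
  define K where "K = cbox (line 2 (-2) (-2)) (line 2 2 2)"
  have K: "compact K" by (simp add: K_def)
  have K_mem: "z \<in> K \<longleftrightarrow> z $ 1 \<in> {-2..2} \<and> z $ 2 \<in> {-2..2}" for z
    by (auto simp: K_def mem_box_cart forall_2 line_nth)
  define C where "C = B * B1 * (\<integral>z. \<bar>v z\<bar> \<partial>(lebesgue_on K)) + B * (\<integral>z. \<bar>G z $ 2\<bar> \<partial>(lebesgue_on K))"
  \<comment> \<open>A common lower bound for the three bumps on the middle halves of their supports.\<close>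
  define \<kappa> where "\<kappa> = (flat (1/4))\<^sup>2"
  have \<kappa>: "\<kappa> > 0" unfolding \<kappa>_def by (rule zero_less_power) (simp add: flat_pos)
  have AE': "AE z in lebesgue. z \<in> cusp_domain \<longrightarrow> v z = cusp_function z"
    using AE cusp_domain_props(1) by (subst (asm) AE_restrict_space_iff) auto
  have claim: "\<kappa> ^ 3 * N / 32 \<le> C" if N: "N \<ge> 2" for N :: real
  proof -
    define \<eta> where "\<eta> x = bump 0 1 ((- N) * x + (N - 1))" for x
    have \<eta>: "smooth \<eta>" unfolding \<eta>_def[abs_def] by (rule smooth_affine[OF smooth_bump])
    have \<eta>01: "0 \<le> \<eta> x" "\<eta> x \<le> 1" for x by (simp_all add: \<eta>_def bump_nonneg bump_le_1)
    have \<eta>out: "\<eta> x = 0" if "x \<notin> {1 - 2 / N..1 - 1 / N}" for x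
      unfolding \<eta>_def by (rule bump_zero) (use that N in \<open>auto simp: field_simps\<close>)
    have "2 / N \<le> 1" "0 < 1 / N" using N by simp_all
    then have sub: "{1 - 2 / N..1 - 1 / N} \<subseteq> {0..<1}"
      unfolding subset_iff atLeastAtMost_iff atLeastLessThan_iff by linarith
    have ne: "{1 - 2 / N..1 - 1 / N} \<noteq> {}" using N by (auto simp: field_simps)
    \<comment> \<open>\<open>\<epsilon>\<close> is the smallest half-width of the cusp over the support of \<open>\<eta>\<close>.\<close>
    obtain x0 where x0: "x0 \<in> {1 - 2 / N..1 - 1 / N}"
      "\<And>x. x \<in> {1 - 2 / N..1 - 1 / N} \<Longrightarrow> height x0 * pinch x0 \<le> height x * pinch x"
      using continuous_attains_inf[OF compact_Icc ne, of "\<lambda>x. height x * pinch x"]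
        continuous_on_subset[OF continuous_on_mult[OF continuous_on_height continuous_on_pinch] subset_UNIV] by blast
    define \<epsilon> where "\<epsilon> = height x0 * pinch x0"
    have "\<bar>x0\<bar> < 1" using sub x0(1) by force
    then have \<epsilon>: "\<epsilon> > 0" unfolding \<epsilon>_def using height_pos_iff pinch_pos_iff by simp
    have \<epsilon>1: "\<epsilon> \<le> 1" unfolding \<epsilon>_def using height_le_1[of x0] height_pinch_le[of x0] by linarith
    define \<beta> where "\<beta> y = S ((1 / \<epsilon>) * y + 0) * T y" for y
    have \<beta>: "smooth \<beta>" unfolding \<beta>_def[abs_def] by (intro smooth_mult smooth_affine S(1) T)
    define b1 b2 where "b1 y = bump (-1) 1 (y / \<epsilon>) / \<epsilon> * T y" and "b2 y = S (y / \<epsilon>) * deriv T y" for y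
    have deriv: "deriv \<beta> y = b1 y + b2 y" for y
    proof (rule DERIV_imp_deriv)
      have "((\<lambda>y. (1 / \<epsilon>) * y + 0) has_real_derivative 1 / \<epsilon>) (at y)"
        using \<epsilon> by (auto intro!: derivative_eq_intros)
      from DERIV_mult[OF DERIV_chain2[OF S(2) this] smooth_has_derivative[OF T, of y]]
      show "(\<beta> has_real_derivative b1 y + b2 y) (at y)"
        by (simp add: \<beta>_def[abs_def] b1_def b2_def algebra_simps)
    qed
    define \<phi> where "\<phi> z = \<eta> (z $ 1) * \<beta> (z $ 2)" for z :: "real^2"
    define \<psi>1 \<psi>2 where "\<psi>1 z = \<eta> (z $ 1) * b1 (z $ 2)" and "\<psi>2 z = \<eta> (z $ 1) * b2 (z $ 2)" for z :: "real^2"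
    have \<eta>out2: "\<eta> x = 0" if "x \<notin> {-2..2}" for x using \<eta>out[of x] sub that by force
    have \<beta>out: "\<beta> y = 0" and b1out: "b1 y = 0" and b2out: "b2 y = 0" if "y \<notin> {-2..2}" for y
      using Tout[OF that] dTout[OF that] by (simp_all add: \<beta>_def b1_def b2_def)
    have test: "test_function UNIV \<phi>"
      unfolding \<phi>_def[abs_def]
      by (rule test_function_tensor[OF \<eta> \<beta>, of "line 2 (-2) (-2)" "line 2 2 2"])
        (simp_all add: line_nth \<eta>out2 \<beta>out)
    have pd: "partial_deriv 2 \<phi> = (\<lambda>z. \<psi>1 z + \<psi>2 z)"
      unfolding \<phi>_def[abs_def] by (subst partial_deriv_tensor[OF \<eta> \<beta>])
        (auto simp: \<psi>1_def \<psi>2_def deriv algebra_simps)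
    have cS: "continuous_on UNIV (\<lambda>y. S (y / \<epsilon>))" "continuous_on UNIV (\<lambda>y. bump (-1) 1 (y / \<epsilon>))"
      using smooth_continuous[OF smooth_affine[OF S(1), of "1 / \<epsilon>" 0]]
        smooth_continuous[OF smooth_affine[OF smooth_bump, of "-1" 1 "1 / \<epsilon>" 0]] by simp_all
    have c1: "continuous_on UNIV \<psi>1"
      unfolding \<psi>1_def[abs_def] using \<epsilon>
      by (intro continuous_on_mult continuous_on_nth_comp smooth_continuous[OF \<eta>])
        (auto simp: b1_def[abs_def] intro!: continuous_intros cS smooth_continuous[OF T])
    have "continuous_on UNIV b2"
      unfolding b2_def[abs_def] by (intro continuous_on_mult cS smooth_continuous[OF smooth_deriv[OF T]])
    then have c2: "continuous_on UNIV \<psi>2"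
      unfolding \<psi>2_def[abs_def]
      by (intro continuous_on_mult continuous_on_nth_comp smooth_continuous[OF \<eta>])
    have z1: "\<psi>1 z = 0" and z2: "\<psi>2 z = 0" and z3: "\<phi> z = 0" if "z \<notin> K" for z
      using that \<eta>out2[of "z $ 1"] b1out[of "z $ 2"] b2out[of "z $ 2"] \<beta>out[of "z $ 2"]
      by (auto simp: K_mem \<psi>1_def \<psi>2_def \<phi>_def)
    have i1: "integrable lebesgue (\<lambda>z. v z * \<psi>1 z)"
      using integrable_loc_mult[OF locv K subset_UNIV _ c1 z1] by (simp add: lebesgue_on_UNIV_eq)
    have i2: "integrable lebesgue (\<lambda>z. v z * \<psi>2 z)"
      using integrable_loc_mult[OF locv K subset_UNIV _ c2 z2] by (simp add: lebesgue_on_UNIV_eq)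
    have "(\<integral>z. v z * partial_deriv 2 \<phi> z \<partial>lebesgue) = - (\<integral>z. G z $ 2 * \<phi> z \<partial>lebesgue)"
      using G test unfolding has_weak_gradient_def lebesgue_on_UNIV_eq by blast
    then have eq: "(\<integral>z. v z * \<psi>1 z \<partial>lebesgue) + (\<integral>z. v z * \<psi>2 z \<partial>lebesgue) = - (\<integral>z. G z $ 2 * \<phi> z \<partial>lebesgue)"
      unfolding pd using i1 i2 by (simp add: distrib_left)
    have "\<bar>\<psi>2 z\<bar> \<le> B * B1" for z
    proof -
      have "\<bar>\<psi>2 z\<bar> = \<eta> (z $ 1) * (S (z $ 2 / \<epsilon>) * \<bar>deriv T (z $ 2)\<bar>)"
        using \<eta>01 S(3) by (simp add: \<psi>2_def b2_def abs_mult)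
      also have "\<dots> \<le> 1 * (B * B1)"
        using \<eta>01 S(3,4) B1 B0 by (intro mult_mono mult_nonneg_nonneg) auto
      finally show ?thesis by simp
    qed
    then have bound2: "\<bar>\<integral>z. v z * \<psi>2 z \<partial>lebesgue\<bar> \<le> B * B1 * (\<integral>z. \<bar>v z\<bar> \<partial>(lebesgue_on K))"
      by (intro integral_loc_mult_bound[OF locv K c2 z2])
    have "\<bar>\<phi> z\<bar> \<le> B" for z
    proof -
      have "\<bar>\<phi> z\<bar> = \<eta> (z $ 1) * (S (z $ 2 / \<epsilon>) * T (z $ 2))"
        using \<eta>01 S(3) T01 by (simp add: \<phi>_def \<beta>_def abs_mult)
      also have "\<dots> \<le> 1 * (B * 1)"
        using \<eta>01 S(3,4) T01 B0 by (intro mult_mono mult_nonneg_nonneg) auto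
      finally show ?thesis by simp
    qed
    then have bound3: "\<bar>\<integral>z. G z $ 2 * \<phi> z \<partial>lebesgue\<bar> \<le> B * (\<integral>z. \<bar>G z $ 2\<bar> \<partial>(lebesgue_on K))"
      by (intro integral_loc_mult_bound[OF locG K test_functionD(2)[OF test] z3])
    have upper: "(\<integral>z. v z * \<psi>1 z \<partial>lebesgue) \<le> C"
      unfolding C_def using eq bound2 bound3 by linarith
    \<comment> \<open>The box on which all three factors of \<open>\<psi>1\<close> are bounded below.\<close>
    define M where "M = cbox (line 2 (1 - 7 / (4 * N)) (- \<epsilon> / 2)) (line 2 (1 - 5 / (4 * N)) (\<epsilon> / 2))"
    have M_mem: "z \<in> M \<longleftrightarrow> z $ 1 \<in> {1 - 7 / (4 * N)..1 - 5 / (4 * N)} \<and> z $ 2 \<in> {- \<epsilon> / 2..\<epsilon> / 2}" for z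
      by (auto simp: M_def mem_box_cart forall_2 line_nth)
    have "line 2 (1 - 3 / (2 * N)) 0 \<in> M"
      using N \<epsilon> by (simp add: M_mem line_nth field_simps)
    then have Mne: "M \<noteq> {}" by blast
    have "measure lebesgue M = (1 - 5 / (4 * N) - (1 - 7 / (4 * N))) * (\<epsilon> / 2 - (- \<epsilon> / 2))"
      using Mne unfolding M_def by (simp add: content_cbox_cart UNIV_2 line_nth)
    then have measM: "measure lebesgue M = \<epsilon> / (2 * N)"
      using N by (simp add: field_simps)
    define c0 where "c0 = N\<^sup>2 / 16 * (\<kappa> * (\<kappa> / \<epsilon> * \<kappa>))"
    have in\<Omega>: "z \<in> cusp_domain" if "z $ 1 \<in> {1 - 2 / N..1 - 1 / N}" "\<bar>z $ 2\<bar> < \<epsilon>" for z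
      using x0(2)[OF that(1)] that(2) by (simp add: cusp_domain_def \<epsilon>_def)
    have psi_out: "\<psi>1 z = 0" if "z \<notin> cusp_domain" for z
    proof (cases "z $ 1 \<in> {1 - 2 / N..1 - 1 / N}")
      case True
      then have "\<not> \<bar>z $ 2\<bar> < \<epsilon>" using in\<Omega> that by blast
      then have "bump (-1) 1 (z $ 2 / \<epsilon>) = 0" using \<epsilon> by (intro bump_zero) (auto simp: field_simps)
      then show ?thesis by (simp add: \<psi>1_def b1_def)
    qed (simp add: \<psi>1_def \<eta>out)
    have psi_nonneg: "0 \<le> \<psi>1 z" for z
      using \<epsilon> \<eta>01 T01 by (simp add: \<psi>1_def b1_def bump_nonneg)
    have M_lower: "c0 \<le> cusp_function z * \<psi>1 z" and M\<Omega>: "z \<in> cusp_domain" if z: "z \<in> M" for z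
    proof -
      have x: "1 - 7 / (4 * N) \<le> z $ 1" "z $ 1 \<le> 1 - 5 / (4 * N)" and y: "\<bar>z $ 2\<bar> \<le> \<epsilon> / 2"
        using z by (auto simp: M_mem abs_le_iff)
      have x': "5 / 4 \<le> N * (1 - z $ 1)" "N * (1 - z $ 1) \<le> 7 / 4" using x N by (simp_all add: field_simps)
      show \<Omega>: "z \<in> cusp_domain"
        using x N y \<epsilon> by (intro in\<Omega>) (auto simp: field_simps)
      have "\<kappa> \<le> \<eta> (z $ 1)" unfolding \<eta>_def \<kappa>_def by (rule bump_ge) (use x' in \<open>auto simp: algebra_simps\<close>)
      moreover have "\<bar>z $ 2 / \<epsilon>\<bar> \<le> 1 / 2" using y \<epsilon> by (simp add: field_simps)
      then have "\<kappa> \<le> bump (-1) 1 (z $ 2 / \<epsilon>)" unfolding \<kappa>_def by (intro bump_ge; linarith)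
      then have "\<kappa> / \<epsilon> \<le> bump (-1) 1 (z $ 2 / \<epsilon>) / \<epsilon>" using \<epsilon> by (simp add: divide_right_mono)
      moreover have "\<kappa> \<le> T (z $ 2)" unfolding \<kappa>_def T_def by (rule bump_ge) (use y \<epsilon>1 in \<open>auto simp: abs_le_iff\<close>)
      moreover have "N\<^sup>2 / 16 \<le> cusp_function z"
      proof -
        define q where "q = 1 - (z $ 1)\<^sup>2"
        have q0: "q > 0" using cusp_domain_D[OF \<Omega>] by (simp add: q_def abs_square_less_1)
        have "q = (1 - z $ 1) * (1 + z $ 1)" by (simp add: q_def power2_eq_square algebra_simps)
        also have "\<dots> \<le> (1 - z $ 1) * 2" using cusp_domain_D[OF \<Omega>] by (intro mult_left_mono) auto
        finally have "N * q \<le> N * ((1 - z $ 1) * 2)" using N by (intro mult_left_mono) auto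
        also have "\<dots> = N * (1 - z $ 1) * 2" by (simp only: mult.assoc)
        also have "\<dots> \<le> 4" using x'(2) by linarith
        finally have "(N * q)\<^sup>2 \<le> 4\<^sup>2" using N q0 by (intro power_mono) auto
        then have "N\<^sup>2 / 16 \<le> 1 / q\<^sup>2" using q0 by (simp add: field_simps power_mult_distrib)
        then show ?thesis by (simp add: cusp_function_def q_def)
      qed
      ultimately show "c0 \<le> cusp_function z * \<psi>1 z"
        unfolding c0_def \<psi>1_def b1_def using \<kappa> \<epsilon> N T01
        by (intro mult_mono) (auto intro!: mult_nonneg_nonneg divide_nonneg_nonneg simp: bump_nonneg cusp_function_def \<eta>01)
    qed
    have iM: "integrable lebesgue (\<lambda>z. c0 * indicator M z)"
      unfolding M_def by (intro integrable_mult_right integrable_real_indicator) (simp_all add: emeasure_lborel_cbox_eq)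
    have "(\<integral>z. c0 * indicator M z \<partial>lebesgue) \<le> (\<integral>z. v z * \<psi>1 z \<partial>lebesgue)"
    proof (rule integral_mono_AE[OF iM i1])
      show "AE z in lebesgue. c0 * indicator M z \<le> v z * \<psi>1 z"
        using AE'
      proof eventually_elim
        case (elim z)
        show ?case
        proof (cases "z \<in> cusp_domain")
          case True
          have "0 \<le> cusp_function z" by (simp add: cusp_function_def)
          then show ?thesis using elim True M_lower[of z] psi_nonneg[of z] by (cases "z \<in> M") auto
        next
          case False
          then have "z \<notin> M" using M\<Omega> by blast
          then show ?thesis using psi_out[OF False] by simp
        qed
      qed
    qed
    then have "c0 * (\<epsilon> / (2 * N)) \<le> C" using upper measM by simp
    moreover have "c0 * (\<epsilon> / (2 * N)) = \<kappa> ^ 3 * N / 32"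
      using \<epsilon> N by (simp add: c0_def power2_eq_square power3_eq_cube field_simps)
    ultimately show ?thesis by (simp only:)
  qed
  obtain n :: nat where n: "max 2 (32 * C / \<kappa> ^ 3) < real n" using reals_Archimedean2 by blast
  then have "\<kappa> ^ 3 * real n / 32 \<le> C" by (intro claim) simp
  then have "real n \<le> 32 * C / \<kappa> ^ 3" using \<kappa> by (simp add: field_simps)
  then show False using n by simp
qed

theorem theorem1p1:
  shows "\<exists>\<Omega> :: (real^2) set. Lp_quasidisk 1 \<Omega> \<and>
           (\<forall>p q :: real. 1 \<le> q \<and> q \<le> p \<longrightarrow> \<not> sobolev_extension_domain p q \<Omega>)"
proof (intro exI[of _ cusp_domain] conjI allI impI notI)
  show "Lp_quasidisk 1 cusp_domain" by (rule quasidisk_cusp_domain)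
  fix p q :: real
  assume pq: "1 \<le> q \<and> q \<le> p" and ext: "sobolev_extension_domain p q cusp_domain"
  have "in_W1p p cusp_domain cusp_function" using pq by (intro cusp_function_in_W1p) simp
  then obtain v where "in_W1p q UNIV v" "AE z in lebesgue_on cusp_domain. v z = cusp_function z"
    using ext unfolding sobolev_extension_domain_def by blast
  then show False using cusp_function_no_extension by (auto simp: in_W1p_def)
qed

end
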